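(* Let $p=p(n)\in[0,1]$, and let $H_{n,p}^{(k)}$ denote the random $k$-uniform hypergraph on vertex set $[n]$. Then the following hold. (i) For all integers $k>\ell\ge 2$ and every fixed $\varepsilon>0$, if $p\le (1-\varepsilon)e^{k-\ell}/n^{k-\ell}$, then with high probability $H_{n,p}^{(k)}$ is not $\ell$-Hamiltonian. (ii) For all integers $k>\ell\ge 3$, there exists a constant $c=c(k)$ such that if $p\ge c/n^{k-\ell}$ and $n$ is a multiple of $k-\ell$, then $H_{n,p}^{(k)}$ is $\ell$-Hamiltonian with high probability. (iii) If $k>\ell=2$, $p\ge \omega/n^{k-2}$, where $\omega=\omega(n)$ is any function tending to infinity with $n$, and $n$ is a multiple of $k-2$, then $H_{n,p}^{(k)}$ is $2$-Hamiltonian with high probability. (iv) For every fixed $\varepsilon>0$, if $k\ge 4$ and $p\ge (1+\varepsilon)e/n$, then with high probability $H_{n,p}^{(k)}$ is $(k-1)$-Hamiltonian, i.e. it contains a tight Hamilton cycle. Here $e$ is the base of natural logarithms.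
   Context: A $k$-uniform hypergraph is a pair $(V,\mathcal{E})$ with $\mathcal{E}\subseteq\binom{V}{k}$. In the random $k$-uniform hypergraph $H_{n,p}^{(k)}$ on vertex set $[n]=\{1,\dots,n\}$, each of the $\binom{n}{k}$ possible $k$-subsets is an edge independently with probability $p$. The integers $k,\ell$ are fixed and asymptotics are as $n\to\infty$. For $1\le \ell<k$, an $\ell$-overlapping Hamilton cycle in a $k$-uniform hypergraph $H=(V,\mathcal{E})$ on $n$ vertices is a collection of $m_\ell=n/(k-\ell)$ edges of $H$ such that, for some cyclic order of the vertices, every edge consists of $k$ consecutive vertices and every pair of consecutive edges $E_{i-1},E_i$ (in the natural cyclic ordering of the edges) satisfies $|E_{i-1}\cap E_i|=\ell$. Equivalently, for some permutation $\pi$ of $[n]$, all the sets $\{\pi((i-1)(k-\ell)+j): j\in[k]\}$, $i=1,\dots,n/(k-\ell)$, are edges of $H$, with the convention $\pi(n+r)=\pi(r)$ for $r>0$. It is always assumed, when discussing $\ell$-overlapping Hamilton cycles, that $k-\ell$ divides $n$. When $\ell=k-1$ the cycle is called a tight Hamilton cycle. A $k$-uniform hypergraph is $\ell$-Hamiltonian if it contains an $\ell$-overlapping Hamilton cycle. An event $\mathcal{E}_n$ occurs with high probability if $\lim_{n\to\infty}\Pr(\mathcal{E}_n)=1$ (the limit being taken over those $n$ divisible by $k-\ell$). *)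

theory Defs
  imports "HOL-Probability.Probability" "HOL-Library.Ramsey"
begin

type_synonym 'a hypergraph = "'a set \<times> 'a set set"

definition uniform_hypergraph :: "nat \<Rightarrow> 'a hypergraph \<Rightarrow> bool" where
  "uniform_hypergraph k H \<longleftrightarrow> snd H \<subseteq> nsets (fst H) k"

definition random_hypergraph :: "nat \<Rightarrow> nat \<Rightarrow> real \<Rightarrow> nat hypergraph pmf" where
  "random_hypergraph k n p =
     map_pmf (\<lambda>X. ({1..n}, {e \<in> nsets {1..n} k. X e}))
       (Pi_pmf (nsets {1..n} k) False (\<lambda>_. bernoulli_pmf p))"

text \<open>A cyclic order of \<open>n\<close> vertices is an enumeration \<open>v 0, \<dots>, v (n - 1)\<close> read modulo \<open>n\<close>;
  \<open>cyclic_arc v n k a\<close> consists of \<open>k\<close> consecutive vertices, the first one being \<open>v a\<close>.\<close>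

definition cyclic_arc :: "(nat \<Rightarrow> 'a) \<Rightarrow> nat \<Rightarrow> nat \<Rightarrow> nat \<Rightarrow> 'a set" where
  "cyclic_arc v n k a = (\<lambda>j. v ((a + j) mod n)) ` {..<k}"

text \<open>The edges are listed in their natural cyclic order, that is, by increasing position
  \<open>s i\<close> of their first vertices. The positions themselves are not prescribed.\<close>

definition overlapping_hamilton_cycle :: "nat \<Rightarrow> nat \<Rightarrow> 'a set \<Rightarrow> 'a set set \<Rightarrow> bool" where
  "overlapping_hamilton_cycle k l V C \<longleftrightarrow>
     (let n = card V; m = n div (k - l) in
        (k - l) dvd n \<and> card C = m \<and>
        (\<exists>v s. bij_betw v {..<n} V \<and>
               strict_mono_on {..<m} s \<and> s ` {..<m} \<subseteq> {..<n} \<and>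
               C = (\<lambda>i. cyclic_arc v n k (s i)) ` {..<m} \<and>
               (\<forall>i<m. card (cyclic_arc v n k (s i) \<inter> cyclic_arc v n k (s (Suc i mod m))) = l)))"

definition l_hamiltonian :: "nat \<Rightarrow> nat \<Rightarrow> 'a hypergraph \<Rightarrow> bool" where
  "l_hamiltonian k l H \<longleftrightarrow> (\<exists>C \<subseteq> snd H. overlapping_hamilton_cycle k l (fst H) C)"

abbreviation tight_hamiltonian :: "nat \<Rightarrow> 'a hypergraph \<Rightarrow> bool" where
  "tight_hamiltonian k H \<equiv> l_hamiltonian k (k - 1) H"

definition multiples_at_top :: "nat \<Rightarrow> nat filter" where
  "multiples_at_top d = inf sequentially (principal {n. d dvd n})"

definition whp :: "nat filter \<Rightarrow> (nat \<Rightarrow> 'a pmf) \<Rightarrow> ('a \<Rightarrow> bool) \<Rightarrow> bool" where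
  "whp F M P \<longleftrightarrow> ((\<lambda>n. measure_pmf.prob (M n) {H. P H}) \<longlongrightarrow> 1) F"

lemma uniform_random_hypergraph:
  "H \<in> set_pmf (random_hypergraph k n p) \<Longrightarrow> fst H = {1..n} \<and> uniform_hypergraph k H"
  by (auto simp: random_hypergraph_def uniform_hypergraph_def)

lemma inj_on_shift_mod: "inj_on (\<lambda>t. (a + t) mod n) {..<n::nat}"
proof (rule linorder_inj_onI)
  fix x y assume xy: "x < y" "x \<in> {..<n}" "y \<in> {..<n}"
  show "(a + x) mod n \<noteq> (a + y) mod n"
  proof
    assume "(a + x) mod n = (a + y) mod n"
    then have "n dvd (a + y) - (a + x)" using xy by (metis add_left_mono less_imp_le mod_eq_dvd_iff_nat)
    then show False using xy by (auto dest: dvd_imp_le)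
  qed
qed auto

lemma card_cyclic_arc_Int:
  assumes v: "inj_on v {..<n}" and a: "a < n" and d: "0 < d" "d < n" and kn: "k \<le> n"
  shows "card (cyclic_arc v n k a \<inter> cyclic_arc v n k ((a + d) mod n)) = (k - d) + (k + d - n)"
proof -
  define f where "f t = (a + t) mod n" for t
  define T where "T = {..<k + d - n} \<union> {d..<k}"
  define D where "D = (\<lambda>j. (d + j) mod n) ` {..<k}"
  have inj: "inj_on (\<lambda>t. v (f t)) {..<n}"
  proof -
    have "f ` {..<n} \<subseteq> {..<n}" using a by (auto simp: f_def)
    then have "inj_on (v \<circ> f) {..<n}"
      using v inj_on_shift_mod[of a n] unfolding f_def
      by (intro comp_inj_on) (auto intro: inj_on_subset)
    then show ?thesis by (simp add: comp_def)
  qed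
  have A: "cyclic_arc v n k a = (\<lambda>t. v (f t)) ` {..<k}"
    by (simp add: cyclic_arc_def f_def)
  have B: "cyclic_arc v n k ((a + d) mod n) = (\<lambda>t. v (f t)) ` D"
    by (auto simp: cyclic_arc_def f_def D_def image_image mod_add_left_eq mod_add_right_eq add.assoc)
  have Dn: "D \<subseteq> {..<n}" using a by (auto simp: D_def)
  have "{..<k} \<inter> D = T"
  proof (intro equalityI subsetI)
    fix t assume t: "t \<in> {..<k} \<inter> D"
    then obtain j where j: "j < k" "t = (d + j) mod n" by (auto simp: D_def)
    show "t \<in> T"
    proof (cases "d + j < n")
      case True then show ?thesis using t j by (auto simp: T_def)
    next
      case False
      then have "t = d + j - n" using j d kn by (simp add: le_mod_geq)
      then show ?thesis using j False by (auto simp: T_def)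
    qed
  next
    fix t assume "t \<in> T"
    then consider "t < k + d - n" | "d \<le> t" "t < k" by (auto simp: T_def)
    then show "t \<in> {..<k} \<inter> D"
    proof cases
      case 1
      then have "t < k" "t + n - d < k" "t = (d + (t + n - d)) mod n" using d kn by auto
      then show ?thesis unfolding D_def by blast
    next
      case 2
      then have "t - d < k" "t = (d + (t - d)) mod n" using kn by auto
      then show ?thesis using 2 unfolding D_def by blast
    qed
  qed
  then have "cyclic_arc v n k a \<inter> cyclic_arc v n k ((a + d) mod n) = (\<lambda>t. v (f t)) ` T"
    unfolding A B using inj_on_image_Int[OF inj, of "{..<k}" D] Dn kn by auto
  moreover have "inj_on (\<lambda>t. v (f t)) T"
    by (rule inj_on_subset[OF inj]) (use kn d in \<open>auto simp: T_def\<close>)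
  moreover have "card T = (k - d) + (k + d - n)"
    unfolding T_def using kn d by (subst card_Un_disjoint) auto
  ultimately show ?thesis by (simp add: card_image)
qed

text \<open>For \<open>n \<ge> 2 * k\<close>, being \<open>l\<close>-Hamiltonian amounts to the existence of a permutation
  \<open>\<pi>\<close> of \<open>{1..n}\<close>, extended by \<open>\<pi> (n + r) = \<pi> r\<close>, all of whose windows
  \<open>\<pi> ((i - 1) * (k - l) + j)\<close>, \<open>1 \<le> j \<le> k\<close>, are edges.\<close>

lemma l_hamiltonian_iff_permutes:
  fixes n k l :: nat
  assumes l: "1 \<le> l" "l < k" and dvd: "(k - l) dvd n" and n: "2 * k \<le> n"
  shows "l_hamiltonian k l ({1..n}, E) \<longleftrightarrow>
    (\<exists>\<pi>. \<pi> permutes {1..n} \<and>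
       (\<forall>i\<in>{1..n div (k - l)}.
          (\<lambda>j. \<pi> (((i - 1) * (k - l) + j - 1) mod n + 1)) ` {1..k} \<in> E))"
    (is "?L \<longleftrightarrow> ?R")
proof -
  define q where "q = k - l"
  define m where "m = n div q"
  have q: "0 < q" "q < k" using l by (auto simp: q_def)
  have mq: "m * q = n" using dvd by (simp add: m_def q_def)
  have m3: "3 \<le> m"
  proof (rule ccontr)
    assume "\<not> 3 \<le> m"
    then have "m * q \<le> 2 * q" by (intro mult_right_mono) auto
    then show False using mq n q by linarith
  qed
  have win: "(\<lambda>j. f ((i * q + j - 1) mod n + 1)) ` {1..k} = cyclic_arc (\<lambda>x. f (x + 1)) n k (i * q)"
    for f :: "nat \<Rightarrow> nat" and i
  proof -
    have "{1..k} = Suc ` {..<k}" by (simp add: image_Suc_lessThan)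
    then show ?thesis by (simp add: cyclic_arc_def image_image)
  qed
  have R: "?R \<longleftrightarrow> (\<exists>\<pi>. \<pi> permutes {1..n} \<and> (\<forall>i<m. cyclic_arc (\<lambda>x. \<pi> (x + 1)) n k (i * q) \<in> E))"
  proof -
    have "(\<forall>i\<in>{1..m}. P (i - 1)) \<longleftrightarrow> (\<forall>i<m. P i)" for P :: "nat \<Rightarrow> bool"
    proof (intro iffI ballI allI impI)
      fix i assume "\<forall>i\<in>{1..m}. P (i - 1)" "i < m"
      then show "P i" by (metis One_nat_def Suc_le_eq atLeastAtMost_iff diff_Suc_1 le_add1 plus_1_eq_Suc)
    qed auto
    from this[of "\<lambda>i. cyclic_arc (\<lambda>x. \<pi> (x + 1)) n k (i * q) \<in> E" for \<pi>] show ?thesis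
      unfolding q_def[symmetric] m_def[symmetric] win by simp
  qed
  show ?thesis
  proof
    assume ?L
    then obtain v s where v: "bij_betw v {..<n} {1..n}" and s: "strict_mono_on {..<m} s"
      and sn: "s ` {..<m} \<subseteq> {..<n}" and E: "(\<lambda>i. cyclic_arc v n k (s i)) ` {..<m} \<subseteq> E"
      and c: "\<And>i. i < m \<Longrightarrow> card (cyclic_arc v n k (s i) \<inter> cyclic_arc v n k (s (Suc i mod m))) = l"
      unfolding l_hamiltonian_def overlapping_hamilton_cycle_def Let_def q_def m_def by auto
    have vi: "inj_on v {..<n}" using v by (rule bij_betw_imp_inj_on)
    have gap: "q \<le> d" if "i < m" "0 < d" "d < n" "s (Suc i mod m) = (s i + d) mod n" for i d
    proof -
      have "s i < n" using that sn by auto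
      from card_cyclic_arc_Int[OF vi this that(2,3), of k] c[OF that(1)] that(4) n
      have "(k - d) + (k + d - n) = l" by simp
      then show ?thesis by (simp add: q_def)
    qed
    have step: "s i + q \<le> s (Suc i)" if "Suc i < m" for i
    proof -
      have *: "s i < s (Suc i)" "s (Suc i) < n"
        using that s sn by (auto simp: strict_mono_on_def)
      then have "s (Suc i) - s i < n" by linarith
      with gap[of i "s (Suc i) - s i"] that * show ?thesis by simp
    qed
    have last: "s (m - 1) + q \<le> s 0 + n"
    proof -
      have *: "s 0 < s (m - 1)"
        using m3 s by (auto simp: strict_mono_on_def)
      have "m - 1 \<in> {..<m}" using m3 by simp
      with sn have **: "s (m - 1) < n" by blast
      define d where "d = s 0 + n - s (m - 1)"
      have d: "0 < d" "d < n" "s (m - 1) + d = s 0 + n" using * ** by (auto simp: d_def)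
      moreover have "Suc (m - 1) mod m = 0" "s 0 < n" using m3 * ** by auto
      ultimately have "q \<le> d" using gap[of "m - 1" d] m3 by simp
      with d(3) show ?thesis by linarith
    qed
    have up: "s i + j * q \<le> s (i + j)" if "i + j < m" for i j
      using that
    proof (induction j)
      case (Suc j)
      then show ?case using step[of "i + j"] by simp
    qed simp
    have si: "s i = s 0 + i * q" if "i < m" for i
    proof -
      have "s 0 + i * q \<le> s i" using up[of 0 i] that by simp
      moreover have "s i + (m - 1 - i) * q \<le> s (m - 1)" using up[of i "m - 1 - i"] that by simp
      moreover have "(m - 1 - i) * q + i * q + q = n"
      proof -
        have "(m - 1 - i) * q + i * q + q = (m - 1 - i + i + 1) * q" by (simp add: algebra_simps)
        also have "m - 1 - i + i + 1 = m" using that by simp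
        finally show ?thesis using mq by simp
      qed
      ultimately show ?thesis using last by linarith
    qed
    define \<pi> where "\<pi> x = (if x \<in> {1..n} then v ((s 0 + (x - 1)) mod n) else x)" for x
    have n0: "0 < n" using n q by linarith
    have "bij_betw (\<lambda>t. (s 0 + t) mod n) {..<n} {..<n}"
    proof -
      have "(\<lambda>t. (s 0 + t) mod n) ` {..<n} \<subseteq> {..<n}" using n0 by auto
      then have "(\<lambda>t. (s 0 + t) mod n) ` {..<n} = {..<n}"
        by (intro endo_inj_surj inj_on_shift_mod) auto
      then show ?thesis using inj_on_shift_mod[of "s 0" n] by (simp add: bij_betw_def)
    qed
    note b1 = bij_betw_trans[OF this v]
    have "bij_betw (\<lambda>x::nat. x - 1) {1..n} {..<n}"
      by (rule bij_betw_byWitness[of _ Suc]) auto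
    note b2 = bij_betw_trans[OF this b1]
    have "bij_betw (\<lambda>x. v ((s 0 + (x - 1)) mod n)) {1..n} {1..n}"
      using b2 by (simp add: comp_def)
    then have "bij_betw \<pi> {1..n} {1..n}"
      by (rule bij_betw_cong[THEN iffD1, rotated]) (simp add: \<pi>_def)
    then have "\<pi> permutes {1..n}"
      by (rule bij_imp_permutes) (auto simp: \<pi>_def)
    moreover have "cyclic_arc (\<lambda>x. \<pi> (x + 1)) n k (i * q) \<in> E" if "i < m" for i
    proof -
      have "\<pi> ((i * q + j) mod n + 1) = v ((s i + j) mod n)" for j
        using n0 si[OF that] by (simp add: \<pi>_def mod_add_right_eq add.assoc Suc_le_eq)
      then have "cyclic_arc (\<lambda>x. \<pi> (x + 1)) n k (i * q) = cyclic_arc v n k (s i)"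
        by (simp add: cyclic_arc_def)
      then show ?thesis using E that by auto
    qed
    ultimately show ?R unfolding R by blast
  next
    assume ?R
    then obtain \<pi> where p: "\<pi> permutes {1..n}"
      and E: "\<And>i. i < m \<Longrightarrow> cyclic_arc (\<lambda>x. \<pi> (x + 1)) n k (i * q) \<in> E"
      unfolding R by blast
    define v where "v x = \<pi> (x + 1)" for x
    have "bij_betw (\<lambda>x::nat. x + 1) {..<n} {1..n}"
      by (rule bij_betw_byWitness[of _ "\<lambda>x. x - 1"]) auto
    from bij_betw_trans[OF this permutes_imp_bij[OF p]] have v: "bij_betw v {..<n} {1..n}"
      by (simp add: comp_def v_def[abs_def])
    then have vi: "inj_on v {..<n}" by (rule bij_betw_imp_inj_on)
    have lt: "i * q < n" if "i < m" for i using that mq q by auto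
    have "card (cyclic_arc v n k (i * q) \<inter> cyclic_arc v n k (Suc i mod m * q)) = l" if "i < m" for i
    proof -
      have "Suc i mod m * q = (i * q + q) mod n"
        using that mq by (metis mod_mult_mult2 mult_Suc add.commute)
      then show ?thesis
        using card_cyclic_arc_Int[OF vi lt[OF that], of q k] n q l by (simp add: q_def)
    qed
    moreover have "inj_on (\<lambda>i. cyclic_arc v n k (i * q)) {..<m}"
    proof (rule linorder_inj_onI)
      fix i j assume ij: "i < j" "i \<in> {..<m}" "j \<in> {..<m}"
      define d where "d = j * q - i * q"
      have lj: "i * q < j * q" "j * q < n" using ij q lt by auto
      then have d: "0 < d" "d < n" "(i * q + d) mod n = j * q" by (auto simp: d_def)
      have "cyclic_arc v n k (i * q) \<noteq> cyclic_arc v n k (j * q)"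
      proof
        assume eq: "cyclic_arc v n k (i * q) = cyclic_arc v n k (j * q)"
        have "card (cyclic_arc v n k (i * q)) = k"
        proof -
          have "inj_on (\<lambda>t. (i * q + t) mod n) {..<k}"
            by (rule inj_on_subset[OF inj_on_shift_mod]) (use n in auto)
          then have "inj_on (v \<circ> (\<lambda>t. (i * q + t) mod n)) {..<k}"
            by (rule comp_inj_on) (rule inj_on_subset[OF vi], use n q in auto)
          then show ?thesis by (simp add: cyclic_arc_def card_image comp_def)
        qed
        then show False
          using card_cyclic_arc_Int[OF vi _ d(1,2), of "i * q" k] lj d n q eq by simp
      qed
      then show "cyclic_arc v n k (i * q) \<noteq> cyclic_arc v n k (j * q)" .
    qed auto
    then have "card ((\<lambda>i. cyclic_arc v n k (i * q)) ` {..<m}) = m" by (simp add: card_image)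
    moreover have "strict_mono_on {..<m} (\<lambda>i. i * q)" using q by (auto simp: strict_mono_on_def)
    moreover have "(\<lambda>i. i * q) ` {..<m} \<subseteq> {..<n}" using lt by auto
    moreover have "(\<lambda>i. cyclic_arc v n k (i * q)) ` {..<m} \<subseteq> E" using E[folded v_def] by blast
    ultimately show ?L
      unfolding l_hamiltonian_def overlapping_hamilton_cycle_def Let_def fst_conv snd_conv
      using v dvd unfolding card_atLeastAtMost diff_Suc_1 q_def[symmetric] m_def[symmetric]
      by blast
  qed
qed

end

theory Submission
  imports Defs
begin

text \<open>Write \<open>d = k - l\<close> and \<open>m = n / d\<close>, and let \<open>X\<close> count the permutations of the vertices that send
  all \<open>m\<close> windows of the standard cyclic order to edges, so that \<open>\<bbbE> X = n! p ^ m\<close>.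

  Below the threshold \<open>\<bbbE> X\<close> tends to \<open>0\<close>, since \<open>n!\<close> is at most \<open>e n (n / e) ^ n\<close> and hence
  \<open>n! p ^ m \<le> e n (1 - \<epsilon>) ^ m\<close> (\<open>whp_not_hamiltonian\<close>).

  Above it, Chebyshev's inequality reduces the claim to \<open>\<bbbE> X\<^sup>2 / (\<bbbE> X)\<^sup>2 \<rightarrow> 1\<close>. By symmetry this ratio
  is the mean of \<open>p ^ (- s)\<close>, where \<open>s\<close> is the number of windows that a uniformly random permutation
  sends to windows, and it exceeds \<open>1\<close> by at most the sum, over the nonempty sets \<open>A\<close> of windows, of
  \<open>p ^ (- card A)\<close> times the probability that all of \<open>A\<close> is sent to windows. The sets \<open>A\<close> are built
  by appending windows one at a time, from left to right, and each appended window is charged for the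
  choices of its image and gains a factor of about \<open>e / n\<close> for every vertex it newly covers:

  \<^item> A window adjacent to the last one covers \<open>d\<close> new vertices and has boundedly many possible
    images, so it contributes a constant over \<open>p (n / e) ^ d\<close>. When \<open>d = 1\<close> the image is
    forced, which is why the sharp constant \<open>e\<close> appears in the tight case.
  \<^item> A window that overlaps the last one but is not adjacent to it covers at least \<open>2 d\<close> new vertices
    and contributes \<open>O(1 / n)\<close>.
  \<^item> A window disjoint from the last one has up to \<open>m\<close> possible positions and \<open>m\<close> possible images,
    and contributes \<open>O(n\<^sup>2 n ^ (- k) / p)\<close>, that is \<open>O(n ^ (2 - l) / c)\<close> for \<open>p = c / n ^ d\<close>.

  If \<open>p\<close> is large enough the total charge of one appended window is a number \<open>r < 1\<close>
  (\<open>sum_step_weight_le\<close>), so the sum over \<open>A\<close> is a geometric series whose first term, the choice of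
  position and image of the first window, is again \<open>O(n ^ (2 - l) / c)\<close>. This tends to \<open>0\<close> if
  \<open>l \<ge> 3\<close>, or if \<open>l = 2\<close> and \<open>c \<rightarrow> \<infinity>\<close>.

  Working from left to right ignores that the order is cyclic. A set \<open>A\<close> with a gap of \<open>k\<close> windows
  can be rotated so that it starts at \<open>0\<close> and avoids the seam. Any other \<open>A\<close> has at least
  \<open>m / k\<close> elements; discarding its windows at the seam costs a polynomial factor, which is beaten by
  \<open>r ^ (m / k)\<close> (\<open>rotate_to_gap_or_dense\<close>, \<open>sum_dense_le\<close>).\<close>

section \<open>The second moment method for families of edge sets\<close>

lemma prob_Pi_bernoulli_all:
  assumes "finite N" "S \<subseteq> N" "0 \<le> p" "p \<le> (1::real)"
  shows "measure_pmf.prob (Pi_pmf N False (\<lambda>_. bernoulli_pmf p)) {X. \<forall>e\<in>S. X e} = p ^ card S"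
proof -
  have "{X. \<forall>e\<in>S. X e} = Pi N (\<lambda>e. if e \<in> S then {True} else UNIV)"
    using assms(2) by (auto simp: Pi_def)
  then have "measure_pmf.prob (Pi_pmf N False (\<lambda>_. bernoulli_pmf p)) {X. \<forall>e\<in>S. X e}
      = (\<Prod>e\<in>N. measure_pmf.prob (bernoulli_pmf p) (if e \<in> S then {True} else UNIV))"
    using assms(1) by (simp add: measure_Pi_pmf_Pi)
  also have "\<dots> = (\<Prod>e\<in>N. if e \<in> S then p else 1)"
    using assms(3,4) by (intro prod.cong) (auto simp: measure_pmf_single)
  also have "\<dots> = (\<Prod>e\<in>S. p)"
    using assms(1,2) by (subst prod.inter_restrict[symmetric]) (auto simp: Int_absorb1)
  finally show ?thesis by simp
qed

lemma finite_set_Pi_bernoulli: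
  "finite N \<Longrightarrow> finite (set_pmf (Pi_pmf N False (\<lambda>_. bernoulli_pmf p)))"
  by (rule finite_subset[OF set_Pi_pmf_subset'])
     (auto intro!: finite_PiE_dflt)

text \<open>If \<open>X\<close> counts the members of the family that survive and \<open>\<mu>\<close> is its mean, then
  \<open>1[X = 0] \<le> (X / \<mu> - 1)\<^sup>2\<close>; the expectation of the right-hand side
  is \<open>\<bbbE> X\<^sup>2 / \<mu>\<^sup>2 - 1\<close>, and the two moments are explicit because a set of \<open>s\<close>
  edges is present with probability \<open>p ^ s\<close>.\<close>

lemma second_moment_none_survives:
  fixes e :: "'i \<Rightarrow> 'e set"
  assumes N: "finite N" and I: "finite I" "I \<noteq> {}"
    and e: "\<And>i. i \<in> I \<Longrightarrow> e i \<subseteq> N" "\<And>i. i \<in> I \<Longrightarrow> card (e i) = m"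
    and p: "0 < p" "p \<le> (1::real)"
  shows "measure_pmf.prob (Pi_pmf N False (\<lambda>_. bernoulli_pmf p)) {X. \<forall>i\<in>I. \<exists>x\<in>e i. \<not> X x}
     \<le> (\<Sum>i\<in>I. \<Sum>j\<in>I. (1 / p) ^ card (e i \<inter> e j)) / real (card I) ^ 2 - 1"
proof -
  define M where "M = Pi_pmf N False (\<lambda>_. bernoulli_pmf p)"
  let ?E = "measure_pmf.expectation M"
  define ind :: "'e set \<Rightarrow> ('e \<Rightarrow> bool) \<Rightarrow> real" where "ind S X = of_bool (\<forall>x\<in>S. X x)" for S X
  define Z where "Z X = (\<Sum>i\<in>I. ind (e i) X)" for X
  define \<mu> where "\<mu> = real (card I) * p ^ m"
  have fin: "finite (set_pmf M)" unfolding M_def by (rule finite_set_Pi_bernoulli[OF N])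
  note [simp] = integrable_measure_pmf_finite[OF fin]
  have fe: "finite (e i)" if "i \<in> I" for i using e(1)[OF that] N by (rule finite_subset)
  have cI: "0 < card I" using I by (simp add: card_gt_0_iff)
  have \<mu>: "0 < \<mu>" using cI p by (simp add: \<mu>_def)
  have ind: "?E (ind S) = p ^ card S" if "S \<subseteq> N" for S
  proof -
    have "?E (ind S) = ?E (indicat_real {X. \<forall>x\<in>S. X x})"
      by (intro Bochner_Integration.integral_cong) (auto simp: ind_def indicator_def)
    also have "\<dots> = p ^ card S"
      using prob_Pi_bernoulli_all[OF N that] p by (simp add: M_def)
    finally show ?thesis .
  qed
  have EZ: "?E Z = \<mu>"
    unfolding Z_def \<mu>_def using ind e by (subst Bochner_Integration.integral_sum) simp_all
  have EZ2: "?E (\<lambda>X. (Z X)\<^sup>2) = p ^ (2 * m) * (\<Sum>i\<in>I. \<Sum>j\<in>I. (1 / p) ^ card (e i \<inter> e j))"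
  proof -
    have "(Z X)\<^sup>2 = (\<Sum>i\<in>I. \<Sum>j\<in>I. ind (e i \<union> e j) X)" for X
      unfolding Z_def power2_eq_square sum_product
      by (intro sum.cong refl) (auto simp: ind_def)
    then have "?E (\<lambda>X. (Z X)\<^sup>2) = (\<Sum>i\<in>I. \<Sum>j\<in>I. ?E (ind (e i \<union> e j)))"
      by (simp add: Bochner_Integration.integral_sum)
    also have "\<dots> = (\<Sum>i\<in>I. \<Sum>j\<in>I. p ^ (2 * m) * (1 / p) ^ card (e i \<inter> e j))"
    proof (intro sum.cong refl)
      fix i j assume ij: "i \<in> I" "j \<in> I"
      have *: "card (e i \<union> e j) + card (e i \<inter> e j) = 2 * m"
        using card_Un_Int[OF fe[OF ij(1)] fe[OF ij(2)]] e(2) ij by simp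
      have "p ^ (2 * m) * (1 / p) ^ card (e i \<inter> e j) = p ^ card (e i \<union> e j)"
        using p unfolding *[symmetric] by (simp add: power_add power_one_over)
      then show "?E (ind (e i \<union> e j)) = p ^ (2 * m) * (1 / p) ^ card (e i \<inter> e j)"
        using ind[of "e i \<union> e j"] e(1) ij by simp
    qed
    finally show ?thesis by (simp add: sum_distrib_left)
  qed
  have "measure_pmf.prob M {X. \<forall>i\<in>I. \<exists>x\<in>e i. \<not> X x}
      = ?E (indicat_real {X. \<forall>i\<in>I. \<exists>x\<in>e i. \<not> X x})" by simp
  also have "\<dots> \<le> ?E (\<lambda>X. (Z X)\<^sup>2 / \<mu>\<^sup>2 - 2 * (Z X / \<mu>) + 1)"
  proof (intro integral_mono_AE AE_I2)
    fix X
    have "Z X = 0" if "\<forall>i\<in>I. \<exists>x\<in>e i. \<not> X x"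
      using that unfolding Z_def by (intro sum.neutral) (auto simp: ind_def)
    moreover have "(Z X)\<^sup>2 / \<mu>\<^sup>2 - 2 * (Z X / \<mu>) + 1 = (Z X / \<mu> - 1)\<^sup>2"
      by (simp add: power2_diff power_divide)
    ultimately show "indicat_real {X. \<forall>i\<in>I. \<exists>x\<in>e i. \<not> X x} X
        \<le> (Z X)\<^sup>2 / \<mu>\<^sup>2 - 2 * (Z X / \<mu>) + 1"
      by (auto simp: indicator_def)
  qed simp_all
  also have "\<dots> = ?E (\<lambda>X. (Z X)\<^sup>2) / \<mu>\<^sup>2 - 2 * (?E Z / \<mu>) + 1"
    by simp
  also have "\<dots> = (\<Sum>i\<in>I. \<Sum>j\<in>I. (1 / p) ^ card (e i \<inter> e j)) / real (card I) ^ 2 - 1"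
  proof -
    have "p ^ (2 * m) * T / \<mu>\<^sup>2 - 2 * (\<mu> / \<mu>) + 1 = T / real (card I) ^ 2 - 1" for T
    proof -
      have "p ^ (2 * m) * T / \<mu>\<^sup>2 = T / real (card I) ^ 2"
        using p by (simp add: \<mu>_def power_mult_distrib power_even_eq)
      then show ?thesis using \<mu> by simp
    qed
    then show ?thesis unfolding EZ EZ2 .
  qed
  finally show ?thesis unfolding M_def .
qed

section \<open>Factorials\<close>

lemma exp_1_le_Suc_div_power:
  assumes "0 < n"
  shows "exp 1 * real n ^ (n + 1) \<le> real (n + 1) ^ (n + 1)"
proof -
  define x :: real where "x = real (n + 1)"
  have x: "0 < x" "real n = (1 + - (1 / x)) * x" by (auto simp: x_def field_simps)
  have "1 + - (1 / x) \<le> exp (- (1 / x))" by (rule exp_ge_add_one_self)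
  then have "(1 + - (1 / x)) ^ (n + 1) \<le> exp (- (1 / x)) ^ (n + 1)"
    using assms by (intro power_mono) (auto simp: x_def)
  also have "\<dots> = exp (real (n + 1) * - (1 / x))" by (rule exp_of_nat_mult[symmetric])
  also have "real (n + 1) * - (1 / x) = - 1" using x(1) by (simp add: x_def)
  finally have "exp 1 * (1 + - (1 / x)) ^ (n + 1) \<le> exp 1 * exp (- 1)"
    by (intro mult_left_mono) auto
  also have "exp 1 * exp (- 1 :: real) = 1" by (simp add: exp_minus)
  finally have "exp 1 * (1 + - (1 / x)) ^ (n + 1) * x ^ (n + 1) \<le> 1 * x ^ (n + 1)"
    using x(1) by (intro mult_right_mono) auto
  then show ?thesis unfolding x(2) power_mult_distrib x_def by (simp add: mult.assoc)
qed

lemma fact_exp_le: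
  assumes "0 < n"
  shows "fact n * exp 1 ^ n \<le> exp 1 * real n ^ (n + 1)"
  using assms
proof (induction n rule: nat_induct_non_zero)
  case (Suc n)
  have "fact (Suc n) * exp 1 ^ Suc n = real (Suc n) * exp 1 * (fact n * exp 1 ^ n)"
    by (simp add: algebra_simps)
  also have "\<dots> \<le> real (Suc n) * exp 1 * (exp 1 * real n ^ (n + 1))"
    by (intro mult_left_mono Suc.IH) auto
  also have "\<dots> \<le> real (Suc n) * exp 1 * real (n + 1) ^ (n + 1)"
    by (intro mult_left_mono exp_1_le_Suc_div_power Suc) auto
  finally show ?case by (simp add: algebra_simps)
qed simp

text \<open>Every fixed placement of \<open>u\<close> vertices is extended by a fraction of at most
  \<open>(e / n) ^ u\<close> of all permutations. The induction loses the factor \<open>(1 + 1 / n) ^ u \<le> e\<close>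
  in each step.\<close>

lemma fact_diff_le:
  assumes "u \<le> n"
  shows "real n ^ u * fact (n - u) \<le> exp 1 ^ u * fact n"
  using assms
proof (induction u arbitrary: n)
  case (Suc u)
  then obtain n' where n: "n = Suc n'" "u \<le> n'" by (cases n) auto
  have *: "real (Suc n') ^ u \<le> exp 1 * real n' ^ u"
  proof (cases "n' = 0")
    case False
    have "(1 + 1 / real n') ^ u \<le> exp (1 / real n') ^ u"
      by (intro power_mono exp_ge_add_one_self) auto
    also have "\<dots> = exp (real u * (1 / real n'))" by (rule exp_of_nat_mult[symmetric])
    also have "\<dots> \<le> exp 1" using n False by (simp add: field_simps)
    finally have "(1 + 1 / real n') ^ u * real n' ^ u \<le> exp 1 * real n' ^ u"
      by (intro mult_right_mono) auto
    also have "(1 + 1 / real n') ^ u * real n' ^ u = ((1 + 1 / real n') * real n') ^ u"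
      by (rule power_mult_distrib[symmetric])
    also have "(1 + 1 / real n') * real n' = real (Suc n')" using False by (simp add: field_simps)
    finally show ?thesis .
  qed (use n in auto)
  have "real n ^ Suc u * fact (n - Suc u) = real n * fact (n' - u) * real (Suc n') ^ u"
    using n by (simp add: algebra_simps)
  also have "\<dots> \<le> real n * fact (n' - u) * (exp 1 * real n' ^ u)"
    by (intro mult_left_mono *) auto
  also have "\<dots> = real n * exp 1 * (real n' ^ u * fact (n' - u))" by (simp add: algebra_simps)
  also have "\<dots> \<le> real n * exp 1 * (exp 1 ^ u * fact n')"
    by (intro mult_left_mono Suc.IH n) auto
  also have "\<dots> = exp 1 ^ Suc u * fact n" using n by (simp add: algebra_simps)
  finally show ?case .
qed simp

section \<open>Fibres\<close>

lemma card_le_card_image_mult: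
  assumes "finite A" "\<And>y. y \<in> f ` A \<Longrightarrow> card {x \<in> A. f x = y} \<le> c"
  shows "card A \<le> c * card (f ` A)"
proof -
  have "A = (\<Union>y\<in>f ` A. {x \<in> A. f x = y})" by auto
  then have "card A \<le> (\<Sum>y\<in>f ` A. card {x \<in> A. f x = y})"
    using card_UN_le[of "f ` A" "\<lambda>y. {x \<in> A. f x = y}"] assms(1) by simp
  also have "\<dots> \<le> card (f ` A) * c" using sum_bounded_above[of "f ` A" _ c] assms(2) by auto
  finally show ?thesis by (simp add: mult.commute)
qed

text \<open>Two extensions of the same partial map differ by a permutation that fixes \<open>U\<close> pointwise.\<close>

lemma card_permutes_extending:
  assumes "finite S" "U \<subseteq> S"
  shows "card {\<sigma>. \<sigma> permutes S \<and> restrict \<sigma> U = f} \<le> fact (card S - card U)"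
proof (cases "\<exists>\<sigma>. \<sigma> permutes S \<and> restrict \<sigma> U = f")
  case True
  then obtain \<tau> where \<tau>: "\<tau> permutes S" "restrict \<tau> U = f" by blast
  have "(\<lambda>\<sigma>. inv \<tau> \<circ> \<sigma>) ` {\<sigma>. \<sigma> permutes S \<and> restrict \<sigma> U = f} \<subseteq> {\<sigma>. \<sigma> permutes S - U}"
  proof (clarsimp)
    fix \<sigma> assume \<sigma>: "\<sigma> permutes S" "f = restrict \<sigma> U"
    have p: "(inv \<tau> \<circ> \<sigma>) permutes S"
      using \<sigma>(1) permutes_inv[OF \<tau>(1)] by (rule permutes_compose)
    have "(inv \<tau> \<circ> \<sigma>) x = x" if "x \<in> U" for x
    proof -
      have "\<sigma> x = \<tau> x" using \<sigma>(2) \<tau>(2) that by (metis restrict_apply')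
      then show ?thesis using permutes_inverses(2)[OF \<tau>(1)] by simp
    qed
    then show "(inv \<tau> \<circ> \<sigma>) permutes S - U" by (intro permutes_superset[OF p]) auto
  qed
  moreover have "inj_on (\<lambda>\<sigma>. inv \<tau> \<circ> \<sigma>) {\<sigma>. \<sigma> permutes S \<and> restrict \<sigma> U = f}"
    by (rule inj_on_inverseI[where g = "\<lambda>\<rho>. \<tau> \<circ> \<rho>"])
       (simp add: fun_eq_iff permutes_inverses(1)[OF \<tau>(1)])
  moreover have "finite {\<sigma>. \<sigma> permutes S - U}" using assms by (intro finite_permutations) auto
  ultimately have "card {\<sigma>. \<sigma> permutes S \<and> restrict \<sigma> U = f} \<le> card {\<sigma>. \<sigma> permutes S - U}"
    by (intro card_inj_on_le)
  also have "\<dots> = fact (card S - card U)"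
    using assms by (intro card_permutations) (auto simp: card_Diff_subset finite_subset)
  finally show ?thesis .
next
  case False
  then have "{\<sigma>. \<sigma> permutes S \<and> restrict \<sigma> U = f} = {}" by blast
  then show ?thesis by (metis card.empty le0)
qed

section \<open>Windows of a cyclic order\<close>

text \<open>The vertices \<open>1, \<dots>, n\<close> are arranged in their natural cyclic order, and the windows are the \<open>m\<close> arcs
  of length \<open>k\<close> that start \<open>d\<close> apart. Any other Hamilton cycle is the image of this one under a
  permutation.\<close>

locale cyclic_windows =
  fixes k d m n :: nat
  assumes d: "0 < d" "d < k" and n: "n = m * d" "2 * k \<le> n"
begin

definition win :: "nat \<Rightarrow> nat set" where
  "win i = cyclic_arc Suc n k (i * d)"

definition wins :: "nat set set" where
  "wins = win ` {..<m}"

lemma m_gt: "k < n" "0 < m"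
proof -
  show "k < n" "0 < m" using d n by (auto intro!: Nat.gr0I)
qed

lemma start_lt: "i < m \<Longrightarrow> i * d < n"
  using d n by simp

lemma finite_wins [simp]: "finite wins"
  by (simp add: wins_def)

lemma card_win: "card (win i) = k"
proof -
  have "inj_on (\<lambda>t. (i * d + t) mod n) {..<k}"
    by (rule inj_on_subset[OF inj_on_shift_mod]) (use m_gt in auto)
  then have "inj_on (\<lambda>j. Suc ((i * d + j) mod n)) {..<k}"
    by (simp add: inj_on_def)
  then show ?thesis by (simp add: win_def cyclic_arc_def card_image)
qed

lemma finite_win [simp]: "finite (win i)"
  by (simp add: win_def cyclic_arc_def)

lemma win_subset: "win i \<subseteq> {1..n}"
  using m_gt by (auto simp: win_def cyclic_arc_def Suc_le_eq)

lemma card_win_Int: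
  assumes "i < j" "j < m"
  shows "card (win i \<inter> win j) = (k - (j - i) * d) + (k + (j - i) * d - n)"
proof -
  have lt: "i * d < j * d" "j * d < n" using assms d start_lt by auto
  then have "(i * d + (j - i) * d) mod n = j * d" using assms by (simp add: add_mult_distrib[symmetric])
  then show ?thesis
    unfolding win_def using card_cyclic_arc_Int[of Suc n "i * d" "(j - i) * d" k] lt m_gt assms
    by (simp add: diff_mult_distrib)
qed

lemma inj_on_win: "inj_on win {..<m}"
proof (rule linorder_inj_onI)
  fix i j assume ij: "i < j" "i \<in> {..<m}" "j \<in> {..<m}"
  have "(j - i) * d \<le> j * d" by simp
  moreover have "0 < (j - i) * d" "j * d < n" using ij d start_lt by auto
  ultimately have "(k - (j - i) * d) + (k + (j - i) * d - n) < k" using n d by linarith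
  then have "card (win i \<inter> win j) < k" using card_win_Int ij by simp
  then show "win i \<noteq> win j" using card_win by auto
qed auto

lemma card_wins: "card wins = m"
  by (simp add: wins_def card_image inj_on_win)

text \<open>A window through \<open>y\<close> is determined by the offset \<open>j < k\<close> of \<open>y\<close> in it.\<close>

lemma card_wins_through: "card {F \<in> wins. y \<in> F} \<le> k"
proof -
  have "{F \<in> wins. y \<in> F} \<subseteq> (\<lambda>j. win (THE i. i < m \<and> Suc ((i * d + j) mod n) = y)) ` {..<k}"
  proof
    fix F assume "F \<in> {F \<in> wins. y \<in> F}"
    then obtain i j where i: "i < m" "F = win i" and j: "j < k" "Suc ((i * d + j) mod n) = y"
      by (auto simp: wins_def win_def cyclic_arc_def)
    have "i' = i" if "i' < m" "Suc ((i' * d + j) mod n) = y" for i'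
    proof -
      have "(j + i' * d) mod n = (j + i * d) mod n" using that j by (simp add: add.commute)
      then have "i' * d = i * d"
        by (rule inj_onD[OF inj_on_shift_mod]) (simp_all add: start_lt that(1) i(1))
      then show ?thesis using d by simp
    qed
    then have "(THE i. i < m \<and> Suc ((i * d + j) mod n) = y) = i"
      using i(1) j(2) by (intro the_equality conjI) (blast | simp)+
    then show "F \<in> (\<lambda>j. win (THE i. i < m \<and> Suc ((i * d + j) mod n) = y)) ` {..<k}"
      using i j by auto
  qed
  then show ?thesis using surj_card_le[of "{..<k}"] by simp
qed

lemma win_linear:
  assumes "i * d + k \<le> n"
  shows "win i = {i * d <.. i * d + k}"
proof -
  have "win i = (\<lambda>j. Suc (i * d + j)) ` {..<k}"
    unfolding win_def cyclic_arc_def using assms by (intro image_cong) auto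
  also have "\<dots> = {i * d <.. i * d + k}"
  proof (intro equalityI subsetI)
    fix x assume "x \<in> {i * d <.. i * d + k}"
    then show "x \<in> (\<lambda>j. Suc (i * d + j)) ` {..<k}"
      by (intro image_eqI[of _ _ "x - Suc (i * d)"]) auto
  qed auto
  finally show ?thesis .
qed

text \<open>The last \<open>k\<close> windows are the only ones that can reach across the seam between \<open>n\<close> and \<open>1\<close>.\<close>

lemma start_linear:
  assumes "i < m - k"
  shows "i * d + k \<le> n"
proof -
  have "(i + k) * d \<le> m * d" using assms by (intro mult_right_mono) auto
  moreover have "k \<le> k * d" using d by simp
  ultimately show ?thesis using n(1) unfolding add_mult_distrib by linarith
qed

text \<open>In a tight cycle the windows meeting a given one in \<open>k - 1\<close> vertices are its two
  neighbours, and these meet each other in \<open>k - 2\<close> vertices only.\<close>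

lemma no_three_tight_windows:
  assumes d1: "d = 1" and F: "{E, F, F'} \<subseteq> wins" "E \<noteq> F" "E \<noteq> F'" "F \<noteq> F'"
    and c: "k - 1 \<le> card (E \<inter> F)" "k - 1 \<le> card (E \<inter> F')" "k - 1 \<le> card (F \<inter> F')"
  shows False
proof -
  have near: "b = a + 1 \<or> b + 1 = a + n"
    if "a < b" "b < m" "k - 1 \<le> card (win a \<inter> win b)" for a b
  proof -
    have "k - 1 \<le> (k - (b - a)) + (k + (b - a) - n)"
      using card_win_Int[OF that(1,2)] that(3) d1 by simp
    then show ?thesis using that d n d1 by (cases "b - a < k") auto
  qed
  obtain a b c where abc: "a < m" "E = win a" "b < m" "F = win b" "c < m" "F' = win c"
    using F(1) by (auto simp: wins_def)
  have near': "y = x + 1 \<or> x = y + 1 \<or> y + 1 = x + n \<or> x + 1 = y + n"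
    if "x \<noteq> y" "x < m" "y < m" "k - 1 \<le> card (win x \<inter> win y)" for x y
    using near[of x y] near[of y x] that by (auto simp: Int_commute neq_iff)
  have "a \<noteq> b" "a \<noteq> c" "b \<noteq> c" using F abc by auto
  with abc c have *: "b = a + 1 \<or> a = b + 1 \<or> b + 1 = a + n \<or> a + 1 = b + n"
    "c = a + 1 \<or> a = c + 1 \<or> c + 1 = a + n \<or> a + 1 = c + n"
    "c = b + 1 \<or> b = c + 1 \<or> c + 1 = b + n \<or> b + 1 = c + n"
    by (intro near'; simp)+
  have lt: "a < n" "b < n" "c < n" "4 \<le> n" using abc n d d1 by auto
  from * show False by (elim disjE) (use lt in linarith)+
qed

section \<open>Permutations that map prescribed windows to windows\<close>

definition good :: "nat set \<Rightarrow> (nat \<Rightarrow> nat) set" where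
  "good A = {\<sigma>. \<sigma> permutes {1..n} \<and> (\<forall>i\<in>A. \<sigma> ` win i \<in> wins)}"

lemma finite_good [simp]: "finite (good A)"
  by (rule finite_subset[OF _ finite_permutations[of "{1..n}"]]) (auto simp: good_def)

lemma good_antimono: "A \<subseteq> B \<Longrightarrow> good B \<subseteq> good A"
  by (auto simp: good_def)

definition rot :: "nat \<Rightarrow> nat \<Rightarrow> nat" where
  "rot a x = (if x \<in> {1..n} then Suc ((a * d + (x - 1)) mod n) else x)"

lemma rot_permutes: "rot a permutes {1..n}"
proof (rule bij_imp_permutes)
  have "rot a ` {1..n} \<subseteq> {1..n}" using m_gt by (auto simp: rot_def Suc_le_eq)
  moreover have "inj_on (rot a) {1..n}"
  proof (rule inj_onI)
    fix x y assume xy: "x \<in> {1..n}" "y \<in> {1..n}" "rot a x = rot a y"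
    then have "x - 1 = y - 1"
      using inj_onD[OF inj_on_shift_mod[of "a * d" n], of "x - 1" "y - 1"]
      by (auto simp: rot_def)
    then show "x = y" using xy by auto
  qed
  ultimately show "bij_betw (rot a) {1..n} {1..n}"
    by (simp add: bij_betw_def endo_inj_surj)
qed (auto simp: rot_def)

lemma rot_win: "rot a ` win i = win ((a + i) mod m)"
proof -
  have "Suc (x mod n) \<in> {1..n}" for x using m_gt by (simp add: Suc_le_eq)
  then have "rot a (Suc (x mod n)) = Suc ((a * d + x) mod n)" for x
    unfolding rot_def by (simp add: mod_add_right_eq)
  then have "rot a ` win i = (\<lambda>j. Suc ((a * d + (i * d + j)) mod n)) ` {..<k}"
    by (simp add: win_def cyclic_arc_def image_image)
  also have "\<dots> = (\<lambda>j. Suc ((((a + i) * d) mod n + j) mod n)) ` {..<k}"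
    by (simp add: mod_add_left_eq add_mult_distrib add.assoc)
  also have "((a + i) * d) mod n = ((a + i) mod m) * d"
    using mod_mult_mult2[of "a + i" d m] n(1) by simp
  finally show ?thesis by (simp add: win_def cyclic_arc_def)
qed

lemma card_good_shift: "card (good ((\<lambda>i. (a + i) mod m) ` B)) \<le> card (good B)"
proof (rule card_inj_on_le)
  show "inj_on (\<lambda>\<sigma>. \<sigma> \<circ> rot a) (good ((\<lambda>i. (a + i) mod m) ` B))"
    by (rule inj_on_inverseI[where g = "\<lambda>\<rho>. \<rho> \<circ> inv (rot a)"])
       (simp add: fun_eq_iff permutes_inverses(1)[OF rot_permutes])
  show "(\<lambda>\<sigma>. \<sigma> \<circ> rot a) ` good ((\<lambda>i. (a + i) mod m) ` B) \<subseteq> good B"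
  proof (rule image_subsetI)
    fix \<sigma> assume \<sigma>: "\<sigma> \<in> good ((\<lambda>i. (a + i) mod m) ` B)"
    have "(\<sigma> \<circ> rot a) ` win i = \<sigma> ` win ((a + i) mod m)" for i
      unfolding rot_win[symmetric] by (simp only: image_comp)
    moreover have "\<sigma> \<circ> rot a permutes {1..n}"
      using \<sigma> by (intro permutes_compose rot_permutes) (simp add: good_def)
    ultimately show "\<sigma> \<circ> rot a \<in> good B"
      using \<sigma> by (simp add: good_def)
  qed
qed simp


section \<open>Partial placements\<close>

definition cov :: "nat set \<Rightarrow> nat set" where
  "cov A = (\<Union>i\<in>A. win i)"

text \<open>The restrictions of good permutations to the covered vertices. Counting these, rather than the
  permutations themselves, makes the count multiplicative when a window is appended.\<close>

definition placements :: "nat set \<Rightarrow> (nat \<Rightarrow> nat) set" where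
  "placements A = (\<lambda>\<sigma>. restrict \<sigma> (cov A)) ` good A"

lemma cov_empty [simp]: "cov {} = {}"
  by (simp add: cov_def)

lemma cov_insert: "cov (insert i A) = win i \<union> cov A"
  by (simp add: cov_def)

lemma cov_subset: "cov A \<subseteq> {1..n}"
  unfolding cov_def using win_subset by (rule UN_least)

lemma finite_cov [simp]: "finite (cov A)"
  using cov_subset by (rule finite_subset) simp

lemma card_cov_le: "card (cov A) \<le> n"
  using card_mono[OF _ cov_subset] by simp

lemma finite_placements [simp]: "finite (placements A)"
  by (simp add: placements_def)

lemma card_placements_empty: "card (placements {}) \<le> 1"
proof -
  have "placements {} \<subseteq> {\<lambda>_. undefined}" by (auto simp: placements_def)
  from card_mono[OF _ this] show ?thesis by simp
qed

lemma card_good_le: "card (good A) \<le> fact (n - card (cov A)) * card (placements A)"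
  unfolding placements_def
proof (rule card_le_card_image_mult)
  fix f
  have "card {\<sigma> \<in> good A. restrict \<sigma> (cov A) = f}
      \<le> card {\<sigma>. \<sigma> permutes {1..n} \<and> restrict \<sigma> (cov A) = f}"
    by (intro card_mono finite_subset[OF _ finite_permutations[of "{1..n}"]])
       (auto simp: good_def)
  also have "\<dots> \<le> fact (n - card (cov A))"
    using card_permutes_extending[of "{1..n}" "cov A"] cov_subset by simp
  finally show "card {\<sigma> \<in> good A. restrict \<sigma> (cov A) = f} \<le> fact (n - card (cov A))" .
qed simp

text \<open>Restricting a placement to the earlier windows again yields a placement, so it suffices to bound
  the number of extensions of each one.\<close>

lemma placements_insert_bound:
  assumes "\<And>\<sigma>. \<sigma> \<in> good A \<Longrightarrow>
    card {g \<in> placements (insert i A). restrict g (cov A) = restrict \<sigma> (cov A)} \<le> c"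
  shows "card (placements (insert i A)) \<le> c * card (placements A)"
proof -
  have sub: "(\<lambda>g. restrict g (cov A)) ` placements (insert i A) \<subseteq> placements A"
  proof (clarsimp simp: placements_def)
    fix \<sigma> assume "\<sigma> \<in> good (insert i A)"
    then have "\<sigma> \<in> good A" using good_antimono by blast
    then show "restrict \<sigma> (cov (insert i A) \<inter> cov A) \<in> (\<lambda>\<sigma>. restrict \<sigma> (cov A)) ` good A"
      by (simp add: cov_insert Int_absorb1)
  qed
  have "card (placements (insert i A)) \<le> c * card ((\<lambda>g. restrict g (cov A)) ` placements (insert i A))"
  proof (rule card_le_card_image_mult)
    fix f assume "f \<in> (\<lambda>g. restrict g (cov A)) ` placements (insert i A)"
    then have "f \<in> placements A" using sub by blast
    then show "card {g \<in> placements (insert i A). restrict g (cov A) = f} \<le> c"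
      using assms by (auto simp: placements_def)
  qed simp
  also have "\<dots> \<le> c * card (placements A)"
    by (intro mult_left_mono card_mono sub) auto
  finally show ?thesis .
qed

lemma extension_agrees:
  assumes "restrict (restrict \<tau> (cov (insert i A))) (cov A) = restrict \<sigma> (cov A)" "x \<in> cov A"
  shows "\<tau> x = \<sigma> x"
  using fun_cong[OF assms(1), of x] assms(2) by (simp add: cov_insert)

text \<open>An extension of a placement to one more window is determined by the window onto which
  that one is mapped and by the images of its new vertices.\<close>

lemma card_extensions_le:
  assumes \<sigma>: "\<sigma> \<in> good A"
    and c: "card {F \<in> wins. \<sigma> ` (win i \<inter> cov A) \<subseteq> F} \<le> c"
  shows "card {g \<in> placements (insert i A). restrict g (cov A) = restrict \<sigma> (cov A)} \<le> c * k ^ k"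
    (is "card ?X \<le> _")
proof -
  define N where "N = win i - cov A"
  define \<F> where "\<F> = {F \<in> wins. \<sigma> ` (win i \<inter> cov A) \<subseteq> F}"
  have N: "finite N" "card N \<le> k"
    using card_mono[of "win i" N] card_win[of i] by (auto simp: N_def)
  have "inj_on (\<lambda>g. restrict g N) ?X"
  proof (rule inj_onI)
    fix g h assume gh: "g \<in> ?X" "h \<in> ?X" "restrict g N = restrict h N"
    have "g x = h x" for x
    proof -
      consider "x \<in> N" | "x \<in> cov A" | "x \<notin> cov (insert i A)"
        unfolding N_def cov_insert by blast
      then show ?thesis
      proof cases
        case 1 then show ?thesis using fun_cong[OF gh(3), of x] by simp
      next
        case 2
        have "restrict g (cov A) = restrict h (cov A)" using gh by simp
        from fun_cong[OF this, of x] 2 show ?thesis by simp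
      next
        case 3
        then have "g x = undefined" "h x = undefined"
          using gh(1,2) by (auto simp: placements_def)
        then show ?thesis by simp
      qed
    qed
    then show "g = h" by (rule ext)
  qed
  moreover have "(\<lambda>g. restrict g N) ` ?X \<subseteq> (\<Union>F\<in>\<F>. N \<rightarrow>\<^sub>E F)"
  proof (rule image_subsetI)
    fix g assume "g \<in> ?X"
    then obtain \<tau> where \<tau>: "\<tau> \<in> good (insert i A)" "g = restrict \<tau> (cov (insert i A))"
      "restrict g (cov A) = restrict \<sigma> (cov A)" by (auto simp: placements_def)
    have "\<sigma> ` (win i \<inter> cov A) \<subseteq> \<tau> ` win i"
    proof (rule image_subsetI)
      fix x assume "x \<in> win i \<inter> cov A"
      then have "x \<in> win i" "\<tau> x = \<sigma> x" using extension_agrees[OF \<tau>(3)[unfolded \<tau>(2)]] by auto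
      then show "\<sigma> x \<in> \<tau> ` win i" by (metis imageI)
    qed
    moreover have "\<tau> ` win i \<in> wins" using \<tau>(1) by (simp add: good_def)
    ultimately have "\<tau> ` win i \<in> \<F>" by (simp add: \<F>_def)
    moreover have "restrict g N \<in> N \<rightarrow>\<^sub>E \<tau> ` win i"
      unfolding restrict_PiE_iff \<tau>(2) N_def cov_insert by simp
    ultimately show "restrict g N \<in> (\<Union>F\<in>\<F>. N \<rightarrow>\<^sub>E F)" by blast
  qed
  moreover have fin: "finite \<F>" "\<And>F. F \<in> \<F> \<Longrightarrow> finite F \<and> card F = k"
    by (auto simp: \<F>_def wins_def card_win)
  ultimately have "card ?X \<le> card (\<Union>F\<in>\<F>. N \<rightarrow>\<^sub>E F)"
    by (intro card_inj_on_le) (auto intro!: finite_PiE N)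
  also have "\<dots> \<le> (\<Sum>F\<in>\<F>. card (N \<rightarrow>\<^sub>E F))" by (intro card_UN_le fin)
  also have "\<dots> \<le> (\<Sum>F\<in>\<F>. k ^ k)"
    using fin N d by (intro sum_mono) (auto simp: card_PiE intro!: power_increasing)
  also have "\<dots> \<le> c * k ^ k" using c by (simp add: \<F>_def)
  finally show ?thesis .
qed

lemma card_placements_new_window:
  "card (placements (insert i A)) \<le> m * k ^ k * card (placements A)"
proof (rule placements_insert_bound)
  fix \<sigma> assume "\<sigma> \<in> good A"
  moreover have "card {F \<in> wins. \<sigma> ` (win i \<inter> cov A) \<subseteq> F} \<le> m"
    using card_mono[of wins "{F \<in> wins. \<sigma> ` (win i \<inter> cov A) \<subseteq> F}"] card_wins by auto
  ultimately show "card {g \<in> placements (insert i A). restrict g (cov A) = restrict \<sigma> (cov A)} \<le> m * k ^ k"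
    by (rule card_extensions_le)
qed

lemma card_placements_overlapping_window:
  assumes "win i \<inter> cov A \<noteq> {}"
  shows "card (placements (insert i A)) \<le> k * k ^ k * card (placements A)"
proof (rule placements_insert_bound)
  fix \<sigma> assume \<sigma>: "\<sigma> \<in> good A"
  from assms obtain x where x: "x \<in> win i \<inter> cov A" by blast
  have "card {F \<in> wins. \<sigma> ` (win i \<inter> cov A) \<subseteq> F} \<le> card {F \<in> wins. \<sigma> x \<in> F}"
    using x by (intro card_mono) auto
  also have "\<dots> \<le> k" by (rule card_wins_through)
  finally show "card {g \<in> placements (insert i A). restrict g (cov A) = restrict \<sigma> (cov A)} \<le> k * k ^ k"
    by (rule card_extensions_le[OF \<sigma>])
qed

text \<open>In the tight case a run of windows is continued in at most one way: the next window
  shares \<open>k - 1\<close> vertices with the last one, and so would two different continuations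
  with each other.\<close>

lemma card_placements_tight_continuation:
  assumes d1: "d = 1" and i: "i \<in> A" "Suc i < m" and new: "win (Suc i) - cov A = {y}" "y \<notin> win i"
    and old: "win (Suc i) \<inter> cov A \<subseteq> win i"
  shows "card (placements (insert (Suc i) A)) \<le> 1 * card (placements A)"
proof (rule placements_insert_bound)
  fix \<sigma> assume \<sigma>: "\<sigma> \<in> good A"
  define O1 where "O1 = win (Suc i) \<inter> win i"
  have winS: "win (Suc i) = insert y O1" "y \<notin> O1"
    using new old unfolding O1_def by blast+
  have iA: "win i \<subseteq> cov A" using i(1) unfolding cov_def by (rule UN_upper)
  have fO: "finite O1" by (simp add: O1_def)
  have cO: "card O1 = k - 1"
    using card_win[of "Suc i"] winS(2) fO unfolding winS(1) by simp
  have key: "\<tau> y = \<tau>' y"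
    if \<tau>: "\<tau> \<in> good (insert (Suc i) A)" "\<tau>' \<in> good (insert (Suc i) A)"
      "\<And>x. x \<in> cov A \<Longrightarrow> \<tau> x = \<sigma> x" "\<And>x. x \<in> cov A \<Longrightarrow> \<tau>' x = \<sigma> x" for \<tau> \<tau>'
  proof -
    have inj: "inj \<tau>" "inj \<tau>'" "inj \<sigma>"
      using \<tau>(1,2) \<sigma> by (auto simp: good_def intro: permutes_inj)
    have agree: "\<tau> ` S = \<sigma> ` S" "\<tau>' ` S = \<sigma> ` S" if "S \<subseteq> win i" for S
    proof -
      have "\<forall>x\<in>S. \<tau> x = \<sigma> x \<and> \<tau>' x = \<sigma> x" using \<tau>(3,4) iA that by blast
      then show "\<tau> ` S = \<sigma> ` S" "\<tau>' ` S = \<sigma> ` S" by simp_all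
    qed
    define E F F' where "E = \<sigma> ` win i" and "F = \<tau> ` win (Suc i)" and "F' = \<tau>' ` win (Suc i)"
    have F: "F = insert (\<tau> y) (\<sigma> ` O1)" "F' = insert (\<tau>' y) (\<sigma> ` O1)"
      unfolding F_def F'_def winS(1) using agree[of O1] by (auto simp: O1_def)
    have new': "\<tau> y \<notin> E" "\<tau>' y \<notin> E"
      using agree[of "win i"] new(2) inj by (metis E_def inj_image_mem_iff order_refl)+
    have yO: "\<tau> y \<notin> \<sigma> ` O1" "\<tau>' y \<notin> \<sigma> ` O1" using new' by (auto simp: E_def O1_def)
    have fin: "finite E" "finite F" "finite F'" by (auto simp: E_def F_def F'_def)
    have cO': "card (\<sigma> ` O1) = k - 1" using cO inj by (simp add: card_image inj_on_subset)
    have "F = F'"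
    proof (rule ccontr)
      assume "F \<noteq> F'"
      moreover have "{E, F, F'} \<subseteq> wins"
        using \<tau>(1,2) \<sigma> i by (auto simp: good_def E_def F_def F'_def)
      moreover have "E \<noteq> F" "E \<noteq> F'" using new' F by blast+
      moreover have "\<sigma> ` O1 \<subseteq> E \<inter> F" "\<sigma> ` O1 \<subseteq> E \<inter> F'" "\<sigma> ` O1 \<subseteq> F \<inter> F'"
        using F by (auto simp: E_def O1_def)
      then have "k - 1 \<le> card (E \<inter> F)" "k - 1 \<le> card (E \<inter> F')" "k - 1 \<le> card (F \<inter> F')"
        using card_mono[of "E \<inter> F" "\<sigma> ` O1"] card_mono[of "E \<inter> F'" "\<sigma> ` O1"]
          card_mono[of "F \<inter> F'" "\<sigma> ` O1"] fin cO' by simp_all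
      ultimately show False using no_three_tight_windows[OF d1, of E F F'] by blast
    qed
    then show ?thesis using F yO by blast
  qed
  have "g = h"
    if "g \<in> placements (insert (Suc i) A)" "restrict g (cov A) = restrict \<sigma> (cov A)"
      "h \<in> placements (insert (Suc i) A)" "restrict h (cov A) = restrict \<sigma> (cov A)" for g h
  proof -
    from that obtain \<tau> \<tau>' where \<tau>: "\<tau> \<in> good (insert (Suc i) A)" "g = restrict \<tau> (cov (insert (Suc i) A))"
      "\<tau>' \<in> good (insert (Suc i) A)" "h = restrict \<tau>' (cov (insert (Suc i) A))"
      by (auto simp: placements_def)
    note eq = extension_agrees[OF that(2)[unfolded \<tau>(2)]]
      extension_agrees[OF that(4)[unfolded \<tau>(4)]]
    have "\<tau> y = \<tau>' y" by (rule key[OF \<tau>(1,3) eq])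
    moreover have "cov (insert (Suc i) A) = insert y (cov A)"
      using new(1) by (auto simp: cov_insert)
    ultimately show "g = h" using eq by (auto simp: \<tau>(2,4) restrict_def fun_eq_iff)
  qed
  then show "card {g \<in> placements (insert (Suc i) A). restrict g (cov A) = restrict \<sigma> (cov A)} \<le> 1"
    by (auto simp: card_le_Suc0_iff_eq)
qed

text \<open>Away from the seam the windows are intervals of equal length, so a new last window meets the
  earlier ones only in what it shares with the last of them.\<close>

lemma append_window:
  assumes A: "A \<subseteq> {..<m - k}" "j \<in> A" "\<forall>i\<in>A. i \<le> j" and i: "j < i" "i < m - k"
  shows "win i \<inter> cov A = {i * d <.. j * d + k}"
    and "win i - cov A = {max (i * d) (j * d + k) <.. i * d + k}"
    and "card (cov (insert i A)) = card (cov A) + min k ((i - j) * d)"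
proof -
  have lin: "win x = {x * d <.. x * d + k}" if "x < m - k" for x
    using win_linear start_linear that by blast
  have ji: "j * d < i * d" using i d by simp
  have sub: "y \<le> j * d + k" if yA: "y \<in> cov A" for y
  proof -
    obtain x where x: "x \<in> A" "y \<in> win x" using yA unfolding cov_def by blast
    then have "y \<le> x * d + k" using lin[of x] A(1) by auto
    also have "x * d \<le> j * d" using A(3) x(1) by simp
    finally show ?thesis by simp
  qed
  have jj: "win j = {j * d <.. j * d + k}" "win j \<subseteq> cov A"
  proof -
    show "win j = {j * d <.. j * d + k}" using lin A(1,2) by blast
    show "win j \<subseteq> cov A" using A(2) unfolding cov_def by (rule UN_upper)
  qed
  show 1: "win i \<inter> cov A = {i * d <.. j * d + k}"
  proof (intro equalityI subsetI)
    fix y assume "y \<in> win i \<inter> cov A"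
    then show "y \<in> {i * d <.. j * d + k}" using sub[of y] lin[OF i(2)] by simp
  next
    fix y assume "y \<in> {i * d <.. j * d + k}"
    then have "y \<in> win j" "y \<in> win i"
      unfolding jj(1) lin[OF i(2)] greaterThanAtMost_iff using ji by linarith+
    then show "y \<in> win i \<inter> cov A" using jj(2) by blast
  qed
  have "win i - cov A = win i - (win i \<inter> cov A)" by blast
  also have "\<dots> = win i - {i * d <.. j * d + k}" by (simp only: 1)
  also have "\<dots> = {max (i * d) (j * d + k) <.. i * d + k}"
    unfolding lin[OF i(2)] by auto
  finally show 2: "win i - cov A = {max (i * d) (j * d + k) <.. i * d + k}" .
  have "card (cov (insert i A)) = card (cov A) + card (win i - cov A)"
  proof -
    have "cov (insert i A) = cov A \<union> (win i - cov A)" by (auto simp: cov_insert)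
    then show ?thesis by (metis card_Un_disjoint Diff_disjoint finite_cov finite_Diff finite_win)
  qed
  then show "card (cov (insert i A)) = card (cov A) + min k ((i - j) * d)"
    unfolding 2 card_greaterThanAtMost diff_mult_distrib using ji by linarith
qed


section \<open>Weights\<close>

text \<open>In the applications \<open>x = 1 / p\<close>. The factor \<open>(e / n) ^ u\<close>, for \<open>u\<close> covered vertices, stands for
  \<open>(n - u)! / n!\<close>; unlike the latter it is exactly multiplicative in \<open>u\<close>.\<close>

definition weight :: "real \<Rightarrow> nat set \<Rightarrow> real" where
  "weight x A = x ^ card A * real (card (placements A)) * (exp 1 / real n) ^ card (cov A)"

text \<open>The factor by which the weight grows at most when a window is appended at distance \<open>\<delta>\<close> from the
  last one: \<open>x\<close> for the new window, \<open>e / n\<close> for each new vertex, and the number of ways to place these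
  vertices, which is \<open>1\<close> for the forced continuation of a tight run.\<close>

definition step_weight :: "real \<Rightarrow> nat \<Rightarrow> real" where
  "step_weight x \<delta> = x * (exp 1 / real n) ^ min k (\<delta> * d) *
     (if k \<le> \<delta> * d then real m * real k ^ k
      else if \<delta> = 1 \<and> d = 1 then 1 else real k * real k ^ k)"

text \<open>Bounds the sum of the step weights over all distances; the three summands account for distance \<open>1\<close>, for
  the other overlapping windows, and for the disjoint ones.\<close>

definition rate :: "real \<Rightarrow> real" where
  "rate x = x * (exp 1 / real n) ^ d * (if d = 1 then 1 else real k * real k ^ k)
     + real k * (x * (exp 1 / real n) ^ (2 * d) * (real k * real k ^ k))
     + real m * (x * (exp 1 / real n) ^ k * (real m * real k ^ k))"

text \<open>The cost of a first window: it covers \<open>k\<close> new vertices and can have any of the \<open>m\<close> images.\<close>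

definition start_weight :: "real \<Rightarrow> real" where
  "start_weight x = x * (exp 1 / real n) ^ k * (real m * real k ^ k)"

lemma exp_div_n: "0 < exp 1 / real n" "exp 1 / real n \<le> 1"
proof -
  have "4 \<le> n" using d n by linarith
  moreover have "exp 1 \<le> (3::real)" by (rule exp_le)
  ultimately have "exp 1 \<le> real n" by linarith
  then show "exp 1 / real n \<le> 1" using \<open>4 \<le> n\<close> by (simp add: divide_le_eq_1)
qed (use m_gt in simp)

lemma weight_nonneg: "0 \<le> x \<Longrightarrow> 0 \<le> weight x A"
  by (simp add: weight_def)

lemma step_weight_nonneg: "0 \<le> x \<Longrightarrow> 0 \<le> step_weight x \<delta>"
  by (simp add: step_weight_def)

lemma weight_insert_le:
  assumes "0 \<le> x" "finite A" "i \<notin> A"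
    and pl: "card (placements (insert i A)) \<le> c * card (placements A)"
    and cv: "card (cov (insert i A)) = card (cov A) + u"
  shows "weight x (insert i A) \<le> weight x A * (x * (exp 1 / real n) ^ u * real c)"
proof -
  have "real (card (placements (insert i A))) \<le> real c * real (card (placements A))"
    using pl by (metis of_nat_le_iff of_nat_mult)
  then have "weight x (insert i A)
      \<le> x ^ Suc (card A) * (real c * real (card (placements A)))
          * (exp 1 / real n) ^ (card (cov A) + u)"
    unfolding weight_def cv using assms by (auto intro!: mult_right_mono mult_left_mono)
  also have "\<dots> = weight x A * (x * (exp 1 / real n) ^ u * real c)"
    by (simp add: weight_def power_add)
  finally show ?thesis .
qed

lemma weight_append_le:
  assumes x: "0 \<le> x"
    and A: "A \<subseteq> {..<m - k}" "j \<in> A" "\<forall>i\<in>A. i \<le> j" and i: "j < i" "i < m - k"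
  shows "weight x (insert i A) \<le> weight x A * step_weight x (i - j)"
proof -
  note app = append_window[OF A i]
  have fin: "finite A" using A(1) by (rule finite_subset) simp
  have new: "i \<notin> A" using A(3) i(1) by (meson not_le)
  note le = weight_insert_le[OF x fin new _ app(3)]
  have ji: "(i - j) * d = i * d - j * d" by (rule diff_mult_distrib)
  consider (far) "k \<le> (i - j) * d"
    | (next_one) "(i - j) * d < k" "i - j = 1" "d = 1"
    | (near) "(i - j) * d < k" "\<not> (i - j = 1 \<and> d = 1)"
    by linarith
  then show ?thesis
  proof cases
    case far
    then show ?thesis using le[OF card_placements_new_window] by (simp add: step_weight_def)
  next
    case next_one
    then have iS: "i = Suc j" by simp
    have wj: "win j = {j * d <.. j * d + k}"
      using win_linear start_linear i by simp
    have k1: "1 < k" using d by linarith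
    have "{max (i * d) (j * d + k) <.. i * d + k} = {Suc (j + k)}"
      using next_one(3) iS k1 by auto
    then have "win (Suc j) - cov A = {Suc (j + k)}" using app(2) iS by (simp only:)
    moreover have "Suc (j + k) \<notin> {j * d <.. j * d + k}" using next_one(3) by simp
    then have "Suc (j + k) \<notin> win j" unfolding wj .
    moreover have "{i * d <.. j * d + k} \<subseteq> {j * d <.. j * d + k}" using iS by auto
    then have "win i \<inter> cov A \<subseteq> win j" unfolding app(1) wj .
    then have "win (Suc j) \<inter> cov A \<subseteq> win j" unfolding iS .
    moreover have "Suc j < m" using iS i(2) by simp
    ultimately have "card (placements (insert i A)) \<le> 1 * card (placements A)"
      unfolding iS using card_placements_tight_continuation[OF next_one(3) A(2)] by blast
    moreover have "(if k \<le> (i - j) * d then real m * real k ^ k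
        else if i - j = 1 \<and> d = 1 then 1 else real k * real k ^ k) = real 1"
      using next_one by auto
    ultimately show ?thesis using le[of 1] unfolding step_weight_def by (simp only:)
  next
    case near
    then have "j * d + k \<in> win i \<inter> cov A"
      unfolding app(1) using ji d i(1) by (simp add: less_diff_conv2)
    then have "card (placements (insert i A)) \<le> k * k ^ k * card (placements A)"
      by (intro card_placements_overlapping_window) blast
    from le[OF this] near show ?thesis by (auto simp: step_weight_def)
  qed
qed

lemma weight_start_le:
  assumes "0 \<le> x"
  shows "weight x {0} \<le> start_weight x"
proof -
  have "weight x (insert 0 {}) \<le> weight x {} * (x * (exp 1 / real n) ^ k * real (m * k ^ k))"
    by (rule weight_insert_le) (use assms card_placements_new_window[of 0 "{}"] in
        \<open>auto simp: cov_insert card_win\<close>)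
  also have "\<dots> \<le> 1 * (x * (exp 1 / real n) ^ k * real (m * k ^ k))"
    by (rule mult_right_mono) (use assms card_placements_empty in \<open>auto simp: weight_def\<close>)
  finally show ?thesis by (simp add: start_weight_def)
qed

text \<open>The weight dominates the contribution of \<open>A\<close> to the second moment.\<close>

lemma prob_good_le_weight:
  assumes "0 \<le> x"
  shows "x ^ card A * real (card (good A)) / fact n \<le> weight x A"
proof -
  define u where "u = card (cov A)"
  have n0: "0 < real n" using m_gt by simp
  have "real n ^ u * fact (n - u) \<le> exp 1 ^ u * (fact n :: real)"
    unfolding u_def by (rule fact_diff_le[OF card_cov_le])
  then have *: "fact (n - u) / fact n \<le> (exp 1 / real n) ^ u"
    using n0 by (simp add: power_divide divide_simps mult.commute)
  have "real (card (good A)) \<le> fact (n - u) * real (card (placements A))"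
    using card_good_le[of A] unfolding u_def by (metis of_nat_fact of_nat_le_iff of_nat_mult)
  then have "x ^ card A * real (card (good A)) / fact n
      \<le> x ^ card A * (fact (n - u) * real (card (placements A))) / fact n"
    using assms by (intro divide_right_mono mult_left_mono) auto
  also have "\<dots> = x ^ card A * real (card (placements A)) * (fact (n - u) / fact n)" by simp
  also have "\<dots> \<le> weight x A"
    unfolding weight_def u_def[symmetric] using assms * by (intro mult_left_mono) auto
  finally show ?thesis .
qed

lemma sum_step_weight_le:
  assumes "0 \<le> x"
  shows "(\<Sum>\<delta>=1..<m. step_weight x \<delta>) \<le> rate x"
proof -
  define a b c where
    "a = x * (exp 1 / real n) ^ d * (if d = 1 then 1 else real k * real k ^ k)"
    and "b = x * (exp 1 / real n) ^ (2 * d) * (real k * real k ^ k)"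
    and "c = x * (exp 1 / real n) ^ k * (real m * real k ^ k)"
  have nonneg: "0 \<le> a" "0 \<le> b" "0 \<le> c" using assms by (auto simp: a_def b_def c_def)
  have "step_weight x \<delta> \<le> (if \<delta> = 1 then a else 0) + (if \<delta> < k then b else 0) + c"
    if \<delta>: "1 \<le> \<delta>" for \<delta>
  proof -
    consider "k \<le> \<delta> * d" | "\<delta> = 1" | "\<delta> * d < k" "2 \<le> \<delta>"
      using \<delta> by (cases "k \<le> \<delta> * d"; cases "\<delta> = 1") auto
    then show ?thesis
    proof cases
      case 1
      then have "step_weight x \<delta> = c" by (simp add: step_weight_def c_def)
      then show ?thesis using nonneg by simp
    next
      case 2
      then have "step_weight x \<delta> = a" using d by (simp add: step_weight_def a_def)
      then show ?thesis using nonneg 2 by simp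
    next
      case 3
      have "\<delta> \<le> \<delta> * d" using d by simp
      then have "\<delta> < k" using 3 by linarith
      have "step_weight x \<delta> = x * (exp 1 / real n) ^ (\<delta> * d) * (real k * real k ^ k)"
        using 3 by (simp add: step_weight_def)
      also have "\<dots> \<le> b"
        unfolding b_def using 3 assms exp_div_n
        by (intro mult_right_mono mult_left_mono power_decreasing) auto
      finally show ?thesis using nonneg 3 \<open>\<delta> < k\<close> by simp
    qed
  qed
  then have "(\<Sum>\<delta>=1..<m. step_weight x \<delta>)
      \<le> (\<Sum>\<delta>=1..<m. (if \<delta> = 1 then a else 0) + (if \<delta> < k then b else 0) + c)"
    by (intro sum_mono) simp
  also have "\<dots> = (\<Sum>\<delta>=1..<m. if \<delta> = 1 then a else 0) + (\<Sum>\<delta>=1..<m. if \<delta> < k then b else 0)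
      + (\<Sum>\<delta>=1..<m. c)"
    by (simp only: sum.distrib)
  also have "\<dots> \<le> a + real k * b + real m * c"
  proof (intro add_mono)
    show "(\<Sum>\<delta>=1..<m. if \<delta> = 1 then a else 0) \<le> a" using nonneg by simp
    have "(\<Sum>\<delta>=1..<m. if \<delta> < k then b else 0) = (\<Sum>\<delta>\<in>{1..<m} \<inter> {..<k}. b)"
      by (subst sum.inter_restrict) auto
    also have "\<dots> \<le> real k * b"
      using nonneg card_mono[of "{..<k}" "{1..<m} \<inter> {..<k}"] by (auto intro!: mult_right_mono)
    finally show "(\<Sum>\<delta>=1..<m. if \<delta> < k then b else 0) \<le> real k * b" .
    show "(\<Sum>\<delta>=1..<m. c) \<le> real m * c" using nonneg by (auto intro!: mult_right_mono)
  qed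
  also have "\<dots> = rate x" by (simp add: rate_def a_def b_def c_def)
  finally show ?thesis .
qed

lemma rate_nonneg: "0 \<le> x \<Longrightarrow> 0 \<le> rate x"
  by (simp add: rate_def)

lemma start_weight_nonneg: "0 \<le> x \<Longrightarrow> 0 \<le> start_weight x"
  by (simp add: start_weight_def)

text \<open>Building a set by appending its elements in increasing order, each new element
  multiplies the total weight by at most \<open>rate x\<close>.\<close>

lemma sum_weight_layer_le:
  assumes x: "0 \<le> x" and b: "1 \<le> b"
  shows "(\<Sum>A | A \<subseteq> {..<m - k} \<and> 0 \<in> A \<and> card A = b. weight x A) \<le> start_weight x * rate x ^ (b - 1)"
  using b
proof (induction b rule: nat_induct_at_least)
  case base
  have "{A. A \<subseteq> {..<m - k} \<and> 0 \<in> A \<and> card A = 1} \<subseteq> {{0}}"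
    by (auto simp: card_1_singleton_iff)
  then have "(\<Sum>A | A \<subseteq> {..<m - k} \<and> 0 \<in> A \<and> card A = 1. weight x A) \<le> (\<Sum>A\<in>{{0}}. weight x A)"
    by (intro sum_mono2) (auto simp: weight_nonneg x)
  then show ?case using weight_start_le[OF x] by simp
next
  case (Suc b)
  let ?L = "\<lambda>b. {A. A \<subseteq> {..<m - k} \<and> 0 \<in> A \<and> card A = b}"
  have fin: "finite (?L b)" for b
    by (rule finite_subset[of _ "Pow {..<m - k}"]) auto
  have "(\<Sum>A\<in>?L (Suc b). weight x A)
      \<le> (\<Sum>(A, i)\<in>(SIGMA A:?L b. {Max A<..<m - k}). weight x A * step_weight x (i - Max A))"
  proof (rule sum_le_included[where i = "\<lambda>(A, i). insert i A"])
    show "\<forall>B\<in>?L (Suc b). \<exists>y\<in>(SIGMA A:?L b. {Max A<..<m - k}).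
        (case y of (A, i) \<Rightarrow> insert i A) = B \<and>
        weight x B \<le> (case y of (A, i) \<Rightarrow> weight x A * step_weight x (i - Max A))"
    proof
      fix B assume "B \<in> ?L (Suc b)"
      then have B: "B \<subseteq> {..<m - k}" "0 \<in> B" "card B = Suc b" by auto
      have fB: "finite B" using B(1) by (rule finite_subset) simp
      define i where "i = Max B"
      define A where "A = B - {i}"
      have iB: "i \<in> B" using fB B(2) unfolding i_def by (intro Max_in) auto
      have "i \<noteq> 0"
      proof
        assume "i = 0"
        then have "B \<subseteq> {0}" using Max_ge[OF fB] by (auto simp: i_def)
        then have "card B \<le> 1" using card_mono[of "{0}" B] by simp
        then show False using B(3) Suc.hyps by simp
      qed
      then have A: "A \<subseteq> {..<m - k}" "0 \<in> A" "card A = b" "insert i A = B" "finite A"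
        using B iB fB by (auto simp: A_def)
      have MaxA: "Max A \<in> A" using A by (intro Max_in) auto
      then have "Max A \<noteq> i" "Max A \<le> i" using Max_ge[OF fB] by (auto simp: A_def i_def)
      then have lt: "Max A < i" "i < m - k" using iB B(1) by auto
      have "weight x (insert i A) \<le> weight x A * step_weight x (i - Max A)"
        by (rule weight_append_le[OF x A(1) MaxA _ lt]) (use Max_ge[OF A(5)] in blast)
      then show "\<exists>y\<in>(SIGMA A:?L b. {Max A<..<m - k}). (case y of (A, i) \<Rightarrow> insert i A) = B \<and>
        weight x B \<le> (case y of (A, i) \<Rightarrow> weight x A * step_weight x (i - Max A))"
        using A lt by (intro bexI[of _ "(A, i)"]) auto
    qed
  qed (auto intro!: fin mult_nonneg_nonneg weight_nonneg step_weight_nonneg x)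
  also have "\<dots> = (\<Sum>A\<in>?L b. \<Sum>i\<in>{Max A<..<m - k}. weight x A * step_weight x (i - Max A))"
    by (rule sum.Sigma[symmetric]) (auto intro: fin)
  also have "\<dots> \<le> (\<Sum>A\<in>?L b. weight x A * rate x)"
  proof (rule sum_mono)
    fix A
    have "(\<Sum>i\<in>{Max A<..<m - k}. step_weight x (i - Max A))
        \<le> (\<Sum>\<delta>=1..<m. step_weight x \<delta>)"
      by (rule sum_le_included[where i = "\<lambda>\<delta>. Max A + \<delta>"])
         (auto intro!: bexI[of _ "_ - Max A"] step_weight_nonneg x)
    also have "\<dots> \<le> rate x" by (rule sum_step_weight_le[OF x])
    finally show "(\<Sum>i\<in>{Max A<..<m - k}. weight x A * step_weight x (i - Max A)) \<le> weight x A * rate x"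
      unfolding sum_distrib_left[symmetric] by (intro mult_left_mono weight_nonneg x)
  qed
  also have "\<dots> = (\<Sum>A\<in>?L b. weight x A) * rate x" by (simp add: sum_distrib_right)
  also have "\<dots> \<le> start_weight x * rate x ^ (b - 1) * rate x"
    by (intro mult_right_mono Suc.IH rate_nonneg x)
  also have "\<dots> = start_weight x * rate x ^ (Suc b - 1)"
    using Suc.hyps by (cases b) (auto simp: mult.assoc)
  finally show ?case .
qed

text \<open>With \<open>b = 1\<close> this bounds the sum over all sets that avoid the seam; large \<open>b\<close> serves for the dense
  sets.\<close>

lemma sum_weight_tail_le:
  assumes x: "0 \<le> x" and r: "rate x < 1" and b: "1 \<le> b"
  shows "(\<Sum>A | A \<subseteq> {..<m - k} \<and> 0 \<in> A \<and> b \<le> card A. weight x A)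
    \<le> start_weight x * rate x ^ (b - 1) / (1 - rate x)"
proof -
  let ?S = "{A. A \<subseteq> {..<m - k} \<and> 0 \<in> A \<and> b \<le> card A}"
  have geo: "(\<Sum>j=b..M. rate x ^ (j - 1)) * (1 - rate x) \<le> rate x ^ (b - 1)" for M
  proof (cases "b \<le> M")
    case True
    then have "(\<Sum>j=b..M. rate x ^ (j - 1)) * (1 - rate x) = rate x ^ (b - 1) - rate x ^ M"
    proof (induction M rule: dec_induct)
      case base
      then show ?case using b by (cases b) (auto simp: algebra_simps)
    next
      case (step M)
      then have "(\<Sum>j=b..Suc M. rate x ^ (j - 1)) * (1 - rate x)
          = (\<Sum>j=b..M. rate x ^ (j - 1)) * (1 - rate x) + rate x ^ M * (1 - rate x)"
        by (simp add: distrib_right)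
      then show ?case unfolding step.IH by (simp add: algebra_simps)
    qed
    then show ?thesis using rate_nonneg[OF x] by simp
  qed (use rate_nonneg[OF x] in simp)
  have fS: "finite ?S" by (rule finite_subset[of _ "Pow {..<m - k}"]) auto
  have cards: "card ` ?S \<subseteq> {b..m}"
  proof (rule image_subsetI)
    fix A assume A: "A \<in> ?S"
    then have "A \<subseteq> {..<m - k}" by simp
    from card_mono[OF _ this] have "card A \<le> m" by simp
    then show "card A \<in> {b..m}" using A by simp
  qed
  have "(\<Sum>A\<in>?S. weight x A) = (\<Sum>j=b..m. \<Sum>A | A \<in> ?S \<and> card A = j. weight x A)"
    using sum.group[OF fS _ cards, of "weight x"] by simp
  also have "\<dots> \<le> (\<Sum>j=b..m. start_weight x * rate x ^ (j - 1))"
  proof (rule sum_mono)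
    fix j assume j: "j \<in> {b..m}"
    then have "{A. A \<in> ?S \<and> card A = j} = {A. A \<subseteq> {..<m - k} \<and> 0 \<in> A \<and> card A = j}" by auto
    then show "(\<Sum>A | A \<in> ?S \<and> card A = j. weight x A) \<le> start_weight x * rate x ^ (j - 1)"
      using sum_weight_layer_le[OF x, of j] j b by simp
  qed
  also have "\<dots> = start_weight x * (\<Sum>j=b..m. rate x ^ (j - 1))" by (simp add: sum_distrib_left)
  also have "\<dots> \<le> start_weight x * (rate x ^ (b - 1) / (1 - rate x))"
    using geo[of m] r by (intro mult_left_mono start_weight_nonneg x) (simp add: pos_le_divide_eq)
  finally show ?thesis by simp
qed


section \<open>Cutting the cycle open\<close>

text \<open>A cyclic set of windows either has a gap of length \<open>k\<close>, and then a rotation moves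
  it off the seam, or it is dense and thus so large that its weight is exponentially small.\<close>

lemma rotate_to_gap_or_dense:
  assumes A: "A \<subseteq> {..<m}" "A \<noteq> {}"
  obtains a B where "a < m" "0 \<in> B" "B \<subseteq> {..<m}" "A = (\<lambda>i. (a + i) mod m) ` B"
    "B \<subseteq> {..<m - k} \<or> m \<le> k * card B"
proof -
  have m0: "0 < m" using m_gt by simp
  define R where "R a = (\<lambda>y. (y + (m - a)) mod m) ` A" for a
  have R: "0 \<in> R a" "R a \<subseteq> {..<m}" "A = (\<lambda>i. (a + i) mod m) ` R a" "card (R a) = card A"
    if "a \<in> A" for a
  proof -
    have a: "a < m" using that A by auto
    have undo: "(a + (y + (m - a)) mod m) mod m = y" if "y \<in> A" for y
    proof -
      have "(a + (y + (m - a)) mod m) mod m = (a + (y + (m - a))) mod m" by (rule mod_add_right_eq)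
      also have "a + (y + (m - a)) = y + m" using a by simp
      finally show ?thesis using that A by auto
    qed
    show "0 \<in> R a" unfolding R_def using that a by (intro image_eqI[of _ _ a]) auto
    show "R a \<subseteq> {..<m}" unfolding R_def using m0 by auto
    show "A = (\<lambda>i. (a + i) mod m) ` R a"
      unfolding R_def image_image using undo by simp
    have "inj_on (\<lambda>y. (y + (m - a)) mod m) A"
      by (rule inj_on_inverseI[where g = "\<lambda>i. (a + i) mod m"]) (rule undo)
    then show "card (R a) = card A" unfolding R_def by (rule card_image)
  qed
  show thesis
  proof (cases "\<exists>a\<in>A. R a \<subseteq> {..<m - k}")
    case True
    then obtain a where "a \<in> A" "R a \<subseteq> {..<m - k}" by blast
    then show thesis using that[of a "R a"] R[of a] A(1) by blast
  next
    case False
    \<comment> \<open>Going backwards from an element of \<open>A\<close>, the next one is at most \<open>k\<close> steps away.\<close>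
    have pred: "\<exists>t\<in>{1..k}. (a + (m - t)) mod m \<in> A \<and> t \<le> m" if aA: "a \<in> A" for a
    proof -
      from False aA have "\<not> R a \<subseteq> {..<m - k}" by blast
      then obtain j where j: "j \<in> R a" "j \<notin> {..<m - k}" by blast
      then have "j < m" using R(2)[OF aA] by blast
      moreover have "(a + j) mod m \<in> A"
        by (subst R(3)[OF aA]) (rule imageI[OF j(1)])
      ultimately have "m - j \<in> {1..k}" "(a + (m - (m - j))) mod m \<in> A" "m - j \<le> m"
        using j(2) by auto
      then show ?thesis by blast
    qed
    \<comment> \<open>The positions followed by an element of \<open>A\<close> within distance less than \<open>k\<close>: closed under
      predecessors, hence everything.\<close>
    define D where "D = {x. x < m \<and> (\<exists>t<k. (x + t) mod m \<in> A)}"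
    have step: "(x + (m - 1)) mod m \<in> D" if xD: "x \<in> D" for x
    proof -
      have k0: "0 < k" using d by simp
      have shift: "((x + (m - 1)) mod m + Suc t) mod m = (x + t) mod m" for t
      proof -
        have "((x + (m - 1)) mod m + Suc t) mod m = (x + (m - 1) + Suc t) mod m"
          by (rule mod_add_left_eq)
        also have "x + (m - 1) + Suc t = x + t + m" using m0 by simp
        finally show ?thesis by simp
      qed
      have lt: "(x + (m - 1)) mod m < m" using m0 by (rule mod_less_divisor)
      from xD obtain t where t: "t < k" "(x + t) mod m \<in> A" unfolding D_def by blast
      show ?thesis
      proof (cases "Suc t < k")
        case True
        moreover have "((x + (m - 1)) mod m + Suc t) mod m \<in> A" unfolding shift by (rule t(2))
        ultimately show ?thesis using lt unfolding D_def by blast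
      next
        case False
        then have tk: "t = k - 1" using t(1) by simp
        obtain s where s: "s \<in> {1..k}" "((x + t) mod m + (m - s)) mod m \<in> A" "s \<le> m"
          using pred[OF t(2)] by blast
        have "((x + (m - 1)) mod m + (k - s)) mod m = (x + (m - 1) + (k - s)) mod m"
          by (rule mod_add_left_eq)
        also have "x + (m - 1) + (k - s) = x + t + (m - s)" using s tk m0 k0 by auto
        also have "\<dots> mod m = ((x + t) mod m + (m - s)) mod m" by (rule mod_add_left_eq[symmetric])
        finally have "((x + (m - 1)) mod m + (k - s)) mod m \<in> A" using s(2) by (simp only:)
        moreover have "k - s < k" using s(1) k0 by simp
        ultimately show ?thesis using lt unfolding D_def by blast
      qed
    qed
    obtain a where a: "a \<in> A" using A by blast
    have aD: "(a + j * (m - 1)) mod m \<in> D" for j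
    proof (induction j)
      case 0
      have "a < m" using a A by blast
      then have "a \<in> D" unfolding D_def using a d by (auto intro!: exI[of _ 0])
      then show ?case using \<open>a < m\<close> by simp
    next
      case (Suc j)
      have "((a + j * (m - 1)) mod m + (m - 1)) mod m = (a + j * (m - 1) + (m - 1)) mod m"
        by (rule mod_add_left_eq)
      moreover have "a + j * (m - 1) + (m - 1) = a + Suc j * (m - 1)" by simp
      ultimately show ?case using step[OF Suc] by (simp only:)
    qed
    have "{..<m} \<subseteq> D"
    proof
      fix y assume y: "y \<in> {..<m}"
      \<comment> \<open>Adding \<open>m - 1\<close> is stepping back by one; \<open>j\<close> steps lead from \<open>a\<close> to \<open>y\<close> modulo \<open>m\<close>.\<close>
      define j where "j = a + (m - y)"
      have "a + j * (m - 1) + j = a + j * m" using m0 by (cases m) (auto simp: algebra_simps)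
      moreover have "j + y = a + m" using y by (simp add: j_def)
      ultimately have "a + j * (m - 1) + m = y + j * m" by linarith
      then have "(a + j * (m - 1) + m) mod m = (y + j * m) mod m" by simp
      then have "(a + j * (m - 1)) mod m = y" using y by simp
      then show "y \<in> D" using aD[of j] by (simp only:)
    qed
    moreover have "D \<subseteq> (\<lambda>(y, t). (y + (m - t mod m)) mod m) ` (A \<times> {..<k})"
    proof
      fix x assume "x \<in> D"
      then obtain t where x: "x < m" and t: "t < k" "(x + t) mod m \<in> A" unfolding D_def by blast
      have "((x + t) mod m + (m - t mod m)) mod m = (x + t mod m + (m - t mod m)) mod m"
      proof -
        have "((x + t) mod m + (m - t mod m)) mod m = ((x + t mod m) mod m + (m - t mod m)) mod m"
          by (simp only: mod_add_right_eq)
        then show ?thesis by (simp only: mod_add_left_eq)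
      qed
      also have "x + t mod m + (m - t mod m) = x + m"
        using mod_less_divisor[OF m0, of t] by linarith
      finally have "x = ((x + t) mod m + (m - t mod m)) mod m" using x by simp
      then show "x \<in> (\<lambda>(y, t). (y + (m - t mod m)) mod m) ` (A \<times> {..<k})"
        using t by (intro image_eqI[of _ _ "((x + t) mod m, t)"]) auto
    qed
    ultimately have "{..<m} \<subseteq> (\<lambda>(y, t). (y + (m - t mod m)) mod m) ` (A \<times> {..<k})" by blast
    moreover have "finite (A \<times> {..<k})" using A finite_subset by blast
    ultimately have "card {..<m} \<le> card (A \<times> {..<k})" by (rule surj_card_le[rotated])
    then have "m \<le> k * card A" by (simp add: card_cartesian_product mult.commute)
    then show thesis using that[of a "R a"] R[OF a] a A(1) by auto
  qed
qed

text \<open>The factor \<open>m\<close> pays for the rotation. It is the price of the position of the first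
  window, so nothing is lost compared with counting the sets directly.\<close>

lemma sum_rotations_le:
  fixes t :: "nat set \<Rightarrow> real"
  assumes t: "\<And>A. 0 \<le> t A" "\<And>a B. B \<subseteq> {..<m} \<Longrightarrow> t ((\<lambda>i. (a + i) mod m) ` B) \<le> t B"
  shows "(\<Sum>A | A \<subseteq> {..<m} \<and> A \<noteq> {}. t A)
    \<le> real m * ((\<Sum>B | B \<subseteq> {..<m - k} \<and> 0 \<in> B. t B)
                 + (\<Sum>B | B \<subseteq> {..<m} \<and> 0 \<in> B \<and> m \<le> k * card B. t B))"
proof -
  let ?S = "{B. B \<subseteq> {..<m - k} \<and> 0 \<in> B}" and ?D = "{B. B \<subseteq> {..<m} \<and> 0 \<in> B \<and> m \<le> k * card B}"
  have fin: "finite ?S" "finite ?D" "finite {A. A \<subseteq> {..<m} \<and> A \<noteq> {}}"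
    by (rule finite_subset[of _ "Pow {..<m}"]; auto)+
  have "(\<Sum>A | A \<subseteq> {..<m} \<and> A \<noteq> {}. t A) \<le> (\<Sum>(a, B)\<in>{..<m} \<times> (?S \<union> ?D). t B)"
  proof (rule sum_le_included[where i = "\<lambda>(a, B). (\<lambda>i. (a + i) mod m) ` B"])
    show "\<forall>A\<in>{A. A \<subseteq> {..<m} \<and> A \<noteq> {}}. \<exists>y\<in>{..<m} \<times> (?S \<union> ?D).
        (case y of (a, B) \<Rightarrow> (\<lambda>i. (a + i) mod m) ` B) = A \<and> t A \<le> (case y of (a, B) \<Rightarrow> t B)"
    proof
      fix A assume "A \<in> {A. A \<subseteq> {..<m} \<and> A \<noteq> {}}"
      then obtain a B where B: "a < m" "0 \<in> B" "B \<subseteq> {..<m}" "A = (\<lambda>i. (a + i) mod m) ` B"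
        "B \<subseteq> {..<m - k} \<or> m \<le> k * card B" using rotate_to_gap_or_dense by blast
      then have "(a, B) \<in> {..<m} \<times> (?S \<union> ?D)" "t A \<le> t B" using t(2) by auto
      then show "\<exists>y\<in>{..<m} \<times> (?S \<union> ?D).
        (case y of (a, B) \<Rightarrow> (\<lambda>i. (a + i) mod m) ` B) = A \<and> t A \<le> (case y of (a, B) \<Rightarrow> t B)"
        using B(4) by (intro bexI[of _ "(a, B)"]) auto
    qed
  qed (use fin t in auto)
  also have "\<dots> = real m * (\<Sum>B\<in>?S \<union> ?D. t B)"
    by (simp add: sum.cartesian_product[symmetric])
  also have "\<dots> \<le> real m * (sum t ?S + sum t ?D)"
  proof (rule mult_left_mono)
    have "sum t (?S \<union> ?D) + sum t (?S \<inter> ?D) = sum t ?S + sum t ?D"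
      by (rule sum.union_inter[OF fin(1,2)])
    moreover have "0 \<le> sum t (?S \<inter> ?D)" by (intro sum_nonneg t)
    ultimately show "sum t (?S \<union> ?D) \<le> sum t ?S + sum t ?D" by linarith
  qed simp
  finally show ?thesis .
qed

text \<open>Deleting the last \<open>k\<close> windows from a dense set leaves at least \<open>m div k - k\<close> of them. What is
  deleted is one of \<open>2 ^ k\<close> sets, and by \<open>x \<ge> 1\<close> it changes the power of \<open>x\<close> by at most \<open>x ^ k\<close>.\<close>

lemma sum_dense_le:
  assumes x: "1 \<le> x" and km: "k < m"
  shows "(\<Sum>B | B \<subseteq> {..<m} \<and> 0 \<in> B \<and> m \<le> k * card B. x ^ card B * real (card (good B)) / fact n)
    \<le> 2 ^ k * x ^ k * (\<Sum>B | B \<subseteq> {..<m - k} \<and> 0 \<in> B \<and> m div k - k \<le> card B. weight x B)"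
proof -
  let ?D = "{B. B \<subseteq> {..<m} \<and> 0 \<in> B \<and> m \<le> k * card B}"
    and ?T = "{B. B \<subseteq> {..<m - k} \<and> 0 \<in> B \<and> m div k - k \<le> card B}"
  have x0: "0 \<le> x" using x by simp
  have fin: "finite ?D" "finite ?T"
    by (rule finite_subset[of _ "Pow {..<m}"]; auto)+
  have "(\<Sum>B\<in>?D. x ^ card B * real (card (good B)) / fact n)
      \<le> (\<Sum>(B, C)\<in>?T \<times> Pow {m - k..<m}. x ^ k * weight x B)"
  proof (rule sum_le_included[where i = "\<lambda>(B, C). B \<union> C"])
    show "\<forall>B\<in>?D. \<exists>y\<in>?T \<times> Pow {m - k..<m}. (case y of (B, C) \<Rightarrow> B \<union> C) = B \<and>
        x ^ card B * real (card (good B)) / fact n \<le> (case y of (B, C) \<Rightarrow> x ^ k * weight x B)"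
    proof
      fix B assume "B \<in> ?D"
      then have B: "B \<subseteq> {..<m}" "0 \<in> B" "m \<le> k * card B" by auto
      define L H where "L = B \<inter> {..<m - k}" and "H = B \<inter> {m - k..<m}"
      have LH: "B = L \<union> H" "L \<inter> H = {}" using B(1) by (auto simp: L_def H_def)
      have fB: "finite B" using B(1) by (rule finite_subset) simp
      have "card H \<le> card {m - k..<m}" by (intro card_mono) (auto simp: H_def)
      then have H: "card H \<le> k" by simp
      have cB: "card B = card L + card H"
        using LH fB by (metis card_Un_disjoint finite_Un)
      have "m div k \<le> card B" using B(3) d by (metis div_le_mono nonzero_mult_div_cancel_left not_less_zero)
      then have "(L, H) \<in> ?T \<times> Pow {m - k..<m}"
        using B H cB km by (auto simp: L_def H_def)
      moreover have "x ^ card B * real (card (good B)) / fact n \<le> x ^ k * weight x L"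
      proof -
        have "x ^ card B \<le> x ^ k * x ^ card L"
          unfolding cB power_add[symmetric] using x H by (intro power_increasing) auto
        moreover have "card (good B) \<le> card (good L)"
          by (intro card_mono good_antimono) (auto simp: L_def)
        ultimately have "x ^ card B * real (card (good B)) / fact n
            \<le> x ^ k * x ^ card L * real (card (good L)) / fact n"
          using x0 by (intro divide_right_mono mult_mono) auto
        also have "\<dots> = x ^ k * (x ^ card L * real (card (good L)) / fact n)" by simp
        also have "\<dots> \<le> x ^ k * weight x L"
          using x0 by (intro mult_left_mono prob_good_le_weight) auto
        finally show ?thesis .
      qed
      ultimately show "\<exists>y\<in>?T \<times> Pow {m - k..<m}. (case y of (B, C) \<Rightarrow> B \<union> C) = B \<and>
        x ^ card B * real (card (good B)) / fact n \<le> (case y of (B, C) \<Rightarrow> x ^ k * weight x B)"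
        using LH(1) by (intro bexI[of _ "(L, H)"]) auto
    qed
  qed (use fin x0 in \<open>auto intro!: mult_nonneg_nonneg weight_nonneg\<close>)
  also have "\<dots> = (\<Sum>B\<in>?T. 2 ^ k * (x ^ k * weight x B))"
    using km by (simp add: sum.cartesian_product[symmetric] card_Pow)
  also have "\<dots> = 2 ^ k * x ^ k * (\<Sum>B\<in>?T. weight x B)"
    by (simp add: sum_distrib_left mult.assoc)
  finally show ?thesis .
qed

section \<open>The probability that no permutation is a Hamilton cycle\<close>

text \<open>If \<open>S\<close> is the set of windows that \<open>\<sigma>\<close> sends to windows, then \<open>x ^ card S\<close> is bounded by the
  sum of \<open>x ^ card A\<close> over all subsets \<open>A\<close> of \<open>S\<close>, and the empty subset accounts for the \<open>1\<close>.\<close>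

lemma sum_shared_le:
  assumes x: "1 \<le> x"
  shows "(\<Sum>\<sigma> | \<sigma> permutes {1..n}. x ^ card {i. i < m \<and> \<sigma> ` win i \<in> wins}) / fact n
    \<le> 1 + (\<Sum>A | A \<subseteq> {..<m} \<and> A \<noteq> {}. x ^ card A * real (card (good A)) / fact n)"
proof -
  let ?P = "{\<sigma>. \<sigma> permutes {1..n}}" and ?A = "{A. A \<subseteq> {..<m} \<and> A \<noteq> {}}"
  have x0: "0 \<le> x" using x by simp
  have fP: "finite ?P" "card ?P = fact n"
    by (auto simp: finite_permutations card_permutations)
  have fA: "finite ?A" by (rule finite_subset[of _ "Pow {..<m}"]) auto
  have count: "(\<Sum>\<sigma>\<in>?P. if \<sigma> \<in> good A then x ^ card A else 0) = x ^ card A * real (card (good A))" for A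
  proof -
    have "good A \<subseteq> ?P" by (auto simp: good_def)
    then have "?P \<inter> good A = good A" by blast
    then show ?thesis
      unfolding sum.inter_restrict[OF fP(1), symmetric] by simp
  qed
  have "(\<Sum>\<sigma>\<in>?P. x ^ card {i. i < m \<and> \<sigma> ` win i \<in> wins})
      \<le> (\<Sum>\<sigma>\<in>?P. 1 + (\<Sum>A\<in>?A. if \<sigma> \<in> good A then x ^ card A else 0))"
  proof (rule sum_mono)
    fix \<sigma> assume \<sigma>: "\<sigma> \<in> ?P"
    define S where "S = {i. i < m \<and> \<sigma> ` win i \<in> wins}"
    have nonneg: "0 \<le> (\<Sum>A\<in>?A. if \<sigma> \<in> good A then x ^ card A else 0)"
      using x0 by (intro sum_nonneg) auto
    show "x ^ card {i. i < m \<and> \<sigma> ` win i \<in> wins}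
        \<le> 1 + (\<Sum>A\<in>?A. if \<sigma> \<in> good A then x ^ card A else 0)"
    proof (cases "S = {}")
      case True
      then show ?thesis using nonneg by (simp add: S_def[symmetric])
    next
      case False
      then have "S \<in> ?A" "\<sigma> \<in> good S" using \<sigma> by (auto simp: S_def good_def)
      then have "x ^ card S \<le> (\<Sum>A\<in>?A. if \<sigma> \<in> good A then x ^ card A else 0)"
        using member_le_sum[of S ?A "\<lambda>A. if \<sigma> \<in> good A then x ^ card A else 0"] fA x0 by auto
      then show ?thesis by (simp add: S_def[symmetric])
    qed
  qed
  also have "\<dots> = fact n + (\<Sum>A\<in>?A. \<Sum>\<sigma>\<in>?P. if \<sigma> \<in> good A then x ^ card A else 0)"
    unfolding sum.distrib by (subst sum.swap) (use fP(2) in simp)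
  also have "\<dots> = fact n + (\<Sum>A\<in>?A. x ^ card A * real (card (good A)))"
    by (simp only: count)
  finally have "(\<Sum>\<sigma>\<in>?P. x ^ card {i. i < m \<and> \<sigma> ` win i \<in> wins}) / fact n
      \<le> (fact n + (\<Sum>A\<in>?A. x ^ card A * real (card (good A)))) / fact n"
    by (intro divide_right_mono) auto
  also have "\<dots> = 1 + (\<Sum>A\<in>?A. x ^ card A * real (card (good A)) / fact n)"
    by (simp add: add_divide_distrib sum_divide_distrib)
  finally show ?thesis .
qed

lemma card_shared:
  assumes "inj \<sigma>"
  shows "card ((`) \<sigma> ` wins \<inter> wins) = card {i. i < m \<and> \<sigma> ` win i \<in> wins}"
proof -
  have "(`) \<sigma> ` wins \<inter> wins = (\<lambda>i. \<sigma> ` win i) ` {i. i < m \<and> \<sigma> ` win i \<in> wins}"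
    by (auto simp: wins_def)
  moreover have "inj_on (\<lambda>i. \<sigma> ` win i) {i. i < m \<and> \<sigma> ` win i \<in> wins}"
  proof (rule inj_onI)
    fix i j assume ij: "i \<in> {i. i < m \<and> \<sigma> ` win i \<in> wins}" "j \<in> {i. i < m \<and> \<sigma> ` win i \<in> wins}"
      "\<sigma> ` win i = \<sigma> ` win j"
    then have "win i = win j" using assms by (simp add: inj_image_eq_iff)
    then show "i = j" using ij inj_onD[OF inj_on_win] by auto
  qed
  ultimately show ?thesis by (simp add: card_image)
qed

text \<open>The number of common edges of two Hamilton cycles is invariant under relabelling, so the
  second permutation may be taken to be the identity.\<close>

lemma sum_pairs_eq:
  fixes x :: real
  shows "(\<Sum>\<tau> | \<tau> permutes {1..n}. \<Sum>\<sigma> | \<sigma> permutes {1..n}. x ^ card ((`) \<tau> ` wins \<inter> (`) \<sigma> ` wins))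
    = fact n * (\<Sum>\<sigma> | \<sigma> permutes {1..n}. x ^ card {i. i < m \<and> \<sigma> ` win i \<in> wins})"
proof -
  let ?P = "{\<sigma>. \<sigma> permutes {1..n}}"
  have inner: "(\<Sum>\<sigma>\<in>?P. x ^ card ((`) \<tau> ` wins \<inter> (`) \<sigma> ` wins))
      = (\<Sum>\<sigma>\<in>?P. x ^ card {i. i < m \<and> \<sigma> ` win i \<in> wins})" if \<tau>: "\<tau> permutes {1..n}" for \<tau>
  proof -
    have "(\<Sum>\<sigma>\<in>?P. x ^ card ((`) \<tau> ` wins \<inter> (`) \<sigma> ` wins))
        = (\<Sum>\<sigma>\<in>?P. x ^ card ((`) \<tau> ` wins \<inter> (`) (\<tau> \<circ> \<sigma>) ` wins))"
      by (rule setum_permutations_compose_left[OF \<tau>])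
    also have "\<dots> = (\<Sum>\<sigma>\<in>?P. x ^ card {i. i < m \<and> \<sigma> ` win i \<in> wins})"
    proof (intro sum.cong refl)
      fix \<sigma> assume "\<sigma> \<in> ?P"
      then have "inj \<sigma>" by (auto intro: permutes_inj)
      have inj: "inj ((`) \<tau>)" using permutes_inj[OF \<tau>] by (simp add: inj_image_eq_iff inj_def)
      have "(`) (\<tau> \<circ> \<sigma>) ` wins = (`) \<tau> ` (`) \<sigma> ` wins"
        by (simp add: image_image image_comp[symmetric])
      then have "(`) \<tau> ` wins \<inter> (`) (\<tau> \<circ> \<sigma>) ` wins = (`) \<tau> ` (wins \<inter> (`) \<sigma> ` wins)"
        using image_Int[OF inj] by simp
      then have "card ((`) \<tau> ` wins \<inter> (`) (\<tau> \<circ> \<sigma>) ` wins) = card (wins \<inter> (`) \<sigma> ` wins)"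
        using inj by (simp add: card_image inj_on_subset)
      then show "x ^ card ((`) \<tau> ` wins \<inter> (`) (\<tau> \<circ> \<sigma>) ` wins)
          = x ^ card {i. i < m \<and> \<sigma> ` win i \<in> wins}"
        using card_shared[OF \<open>inj \<sigma>\<close>] by (simp add: Int_commute)
    qed
    finally show ?thesis .
  qed
  have "card ?P = fact n" by (simp add: card_permutations)
  then show ?thesis using inner by simp
qed

lemma image_wins:
  assumes "\<sigma> permutes {1..n}"
  shows "(`) \<sigma> ` wins \<subseteq> nsets {1..n} k" "card ((`) \<sigma> ` wins) = m"
proof -
  have inj: "inj \<sigma>" using assms by (rule permutes_inj)
  have "\<sigma> ` win i \<in> nsets {1..n} k" for i
  proof -
    have "\<sigma> ` win i \<subseteq> {1..n}"
      using win_subset[of i] permutes_image[OF assms] by (metis image_mono)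
    moreover have "card (\<sigma> ` win i) = k"
      using inj card_win by (simp add: card_image inj_on_subset)
    ultimately show ?thesis by (simp add: nsets_def)
  qed
  then show "(`) \<sigma> ` wins \<subseteq> nsets {1..n} k" by (auto simp: wins_def)
  have "inj ((`) \<sigma>)" using inj by (simp add: inj_image_eq_iff inj_def)
  then show "card ((`) \<sigma> ` wins) = m"
    using card_wins by (simp add: card_image inj_on_subset)
qed

lemma prob_no_image_wins_le:
  assumes p: "0 < p" "p \<le> 1" and r: "rate (1 / p) < 1" and b: "k < m div k"
  shows "measure_pmf.prob (Pi_pmf (nsets {1..n} k) False (\<lambda>_. bernoulli_pmf p))
      {X. \<forall>\<sigma>\<in>{\<sigma>. \<sigma> permutes {1..n}}. \<exists>e\<in>(`) \<sigma> ` wins. \<not> X e}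
    \<le> real m * start_weight (1 / p) / (1 - rate (1 / p))
       * (1 + 2 ^ k * (1 / p) ^ k * rate (1 / p) ^ (m div k - k - 1))"
proof -
  define x where "x = 1 / p"
  have x: "1 \<le> x" "0 \<le> x" using p by (auto simp: x_def)
  let ?P = "{\<sigma>. \<sigma> permutes {1..n}}"
  let ?t = "\<lambda>A. x ^ card A * real (card (good A)) / fact n"
  have P: "finite ?P" "card ?P = fact n" "?P \<noteq> {}"
    using permutes_id[of "{1..n}"] by (blast | simp add: finite_permutations card_permutations)+
  have "finite (nsets {1..n} k)"
    by (rule finite_imp_finite_nsets) simp
  from second_moment_none_survives[OF this P(1,3) image_wins p]
  have "measure_pmf.prob (Pi_pmf (nsets {1..n} k) False (\<lambda>_. bernoulli_pmf p))
      {X. \<forall>\<sigma>\<in>?P. \<exists>e\<in>(`) \<sigma> ` wins. \<not> X e}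
    \<le> (\<Sum>\<tau>\<in>?P. \<Sum>\<sigma>\<in>?P. x ^ card ((`) \<tau> ` wins \<inter> (`) \<sigma> ` wins)) / (fact n)\<^sup>2 - 1"
    unfolding P(2) x_def by simp
  also have "\<dots> = (\<Sum>\<sigma>\<in>?P. x ^ card {i. i < m \<and> \<sigma> ` win i \<in> wins}) / fact n - 1"
    unfolding sum_pairs_eq by (simp add: power2_eq_square)
  also have "\<dots> \<le> (\<Sum>A | A \<subseteq> {..<m} \<and> A \<noteq> {}. ?t A)"
    using sum_shared_le[OF x(1)] by linarith
  also have "\<dots> \<le> real m * ((\<Sum>B | B \<subseteq> {..<m - k} \<and> 0 \<in> B. ?t B)
      + (\<Sum>B | B \<subseteq> {..<m} \<and> 0 \<in> B \<and> m \<le> k * card B. ?t B))"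
  proof (rule sum_rotations_le)
    fix a B assume B: "B \<subseteq> {..<m}"
    have "inj_on (\<lambda>i. (a + i) mod m) B" by (rule inj_on_subset[OF inj_on_shift_mod B])
    then have "card ((\<lambda>i. (a + i) mod m) ` B) = card B" by (rule card_image)
    then show "?t ((\<lambda>i. (a + i) mod m) ` B) \<le> ?t B"
      using card_good_shift[of a B] x(2) by (auto intro!: divide_right_mono mult_left_mono)
  qed (use x(2) in auto)
  also have "\<dots> \<le> real m * (start_weight x / (1 - rate x)
      + 2 ^ k * x ^ k * (start_weight x * rate x ^ (m div k - k - 1) / (1 - rate x)))"
  proof (intro mult_left_mono add_mono)
    have "{B. B \<subseteq> {..<m - k} \<and> 0 \<in> B} = {B. B \<subseteq> {..<m - k} \<and> 0 \<in> B \<and> 1 \<le> card B}"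
      by (auto simp: Suc_le_eq card_gt_0_iff dest: finite_subset)
    then have "(\<Sum>B | B \<subseteq> {..<m - k} \<and> 0 \<in> B. ?t B)
        \<le> (\<Sum>B | B \<subseteq> {..<m - k} \<and> 0 \<in> B \<and> 1 \<le> card B. weight x B)"
      using prob_good_le_weight[OF x(2)] by (simp add: sum_mono)
    also have "\<dots> \<le> start_weight x * rate x ^ (1 - 1) / (1 - rate x)"
      using r by (intro sum_weight_tail_le x) (auto simp: x_def)
    finally show "(\<Sum>B | B \<subseteq> {..<m - k} \<and> 0 \<in> B. ?t B) \<le> start_weight x / (1 - rate x)" by simp
    have "(\<Sum>B | B \<subseteq> {..<m} \<and> 0 \<in> B \<and> m \<le> k * card B. ?t B)
        \<le> 2 ^ k * x ^ k * (\<Sum>B | B \<subseteq> {..<m - k} \<and> 0 \<in> B \<and> m div k - k \<le> card B. weight x B)"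
      by (rule sum_dense_le[OF x(1)]) (use b div_le_dividend[of m k] in linarith)
    also have "\<dots> \<le> 2 ^ k * x ^ k * (start_weight x * rate x ^ (m div k - k - 1) / (1 - rate x))"
      using r b x(2) by (intro mult_left_mono sum_weight_tail_le) (auto simp: x_def)
    finally show "(\<Sum>B | B \<subseteq> {..<m} \<and> 0 \<in> B \<and> m \<le> k * card B. ?t B)
        \<le> 2 ^ k * x ^ k * (start_weight x * rate x ^ (m div k - k - 1) / (1 - rate x))" .
  qed simp
  also have "\<dots> = real m * start_weight x / (1 - rate x)
       * (1 + 2 ^ k * x ^ k * rate x ^ (m div k - k - 1))"
    by (simp add: algebra_simps)
  finally show ?thesis unfolding x_def .
qed

end

section \<open>Random hypergraphs\<close>

context cyclic_windows
begin

lemma l_hamiltonian_iff_image_wins: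
  assumes l: "1 \<le> l" "l < k" "d = k - l"
  shows "l_hamiltonian k l ({1..n}, E) \<longleftrightarrow> (\<exists>\<sigma>. \<sigma> permutes {1..n} \<and> (`) \<sigma> ` wins \<subseteq> E)"
proof -
  have dvd: "(k - l) dvd n" using n(1) l(3) by simp
  have m: "n div (k - l) = m" using n(1) l(3) d(1) by simp
  have wins_eq: "(\<lambda>j. \<sigma> (((i - 1) * (k - l) + j - 1) mod n + 1)) ` {1..k} = \<sigma> ` win (i - 1)" for \<sigma> i
  proof -
    have "{1..k} = Suc ` {..<k}" by (simp add: image_Suc_lessThan)
    then show ?thesis
      unfolding win_def cyclic_arc_def l(3)[symmetric] by (simp add: image_image)
  qed
  have all_eq: "(\<forall>i\<in>{1..m}. \<sigma> ` win (i - 1) \<in> E) \<longleftrightarrow> (`) \<sigma> ` wins \<subseteq> E" for \<sigma>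
  proof
    assume *: "\<forall>i\<in>{1..m}. \<sigma> ` win (i - 1) \<in> E"
    have "\<sigma> ` win i \<in> E" if "i < m" for i using *[rule_format, of "Suc i"] that by simp
    then show "(`) \<sigma> ` wins \<subseteq> E" by (auto simp: wins_def)
  next
    assume *: "(`) \<sigma> ` wins \<subseteq> E"
    show "\<forall>i\<in>{1..m}. \<sigma> ` win (i - 1) \<in> E"
    proof
      fix i assume "i \<in> {1..m}"
      then have "i - 1 < m" by auto
      then have "win (i - 1) \<in> wins" unfolding wins_def by blast
      then show "\<sigma> ` win (i - 1) \<in> E" using * by blast
    qed
  qed
  show ?thesis
    unfolding l_hamiltonian_iff_permutes[OF l(1,2) dvd n(2)] m wins_eq all_eq ..
qed

lemma prob_random_hypergraph:
  assumes l: "1 \<le> l" "l < k" "d = k - l"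
  shows "measure_pmf.prob (random_hypergraph k n p) {H. l_hamiltonian k l H}
    = measure_pmf.prob (Pi_pmf (nsets {1..n} k) False (\<lambda>_. bernoulli_pmf p))
        (\<Union>\<sigma>\<in>{\<sigma>. \<sigma> permutes {1..n}}. {X. \<forall>e\<in>(`) \<sigma> ` wins. X e})" (is "_ = ?R")
    and "measure_pmf.prob (random_hypergraph k n p) {H. \<not> l_hamiltonian k l H}
    = measure_pmf.prob (Pi_pmf (nsets {1..n} k) False (\<lambda>_. bernoulli_pmf p))
        {X. \<forall>\<sigma>\<in>{\<sigma>. \<sigma> permutes {1..n}}. \<exists>e\<in>(`) \<sigma> ` wins. \<not> X e}" (is "_ = ?R'")
proof -
  have iff: "l_hamiltonian k l ({1..n}, {e \<in> nsets {1..n} k. X e})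
      \<longleftrightarrow> (\<exists>\<sigma>. \<sigma> permutes {1..n} \<and> (\<forall>e\<in>(`) \<sigma> ` wins. X e))" for X
  proof -
    have "S \<subseteq> {e \<in> N. X e} \<longleftrightarrow> (\<forall>e\<in>S. X e)" if "S \<subseteq> N" for S N :: "nat set set"
      using that by blast
    then have "(`) \<sigma> ` wins \<subseteq> {e \<in> nsets {1..n} k. X e} \<longleftrightarrow> (\<forall>e\<in>(`) \<sigma> ` wins. X e)"
      if "\<sigma> permutes {1..n}" for \<sigma> using image_wins(1)[OF that] by this
    then show ?thesis
      unfolding l_hamiltonian_iff_image_wins[OF l] by (intro iff_exI conj_cong refl)
  qed
  have "(\<lambda>X. ({1..n}, {e \<in> nsets {1..n} k. X e})) -` {H. l_hamiltonian k l H}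
      = (\<Union>\<sigma>\<in>{\<sigma>. \<sigma> permutes {1..n}}. {X. \<forall>e\<in>(`) \<sigma> ` wins. X e})"
    unfolding vimage_def mem_Collect_eq iff by blast
  then show "measure_pmf.prob (random_hypergraph k n p) {H. l_hamiltonian k l H} = ?R"
    unfolding random_hypergraph_def measure_map_pmf by simp
  have "(\<lambda>X. ({1..n}, {e \<in> nsets {1..n} k. X e})) -` {H. \<not> l_hamiltonian k l H}
      = {X. \<forall>\<sigma>\<in>{\<sigma>. \<sigma> permutes {1..n}}. \<exists>e\<in>(`) \<sigma> ` wins. \<not> X e}"
    unfolding vimage_def mem_Collect_eq iff by blast
  then show "measure_pmf.prob (random_hypergraph k n p) {H. \<not> l_hamiltonian k l H} = ?R'"
    unfolding random_hypergraph_def measure_map_pmf by simp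
qed

lemma prob_hamiltonian_le:
  assumes l: "1 \<le> l" "l < k" "d = k - l" and p: "0 \<le> p" "p \<le> 1"
  shows "measure_pmf.prob (random_hypergraph k n p) {H. l_hamiltonian k l H} \<le> fact n * p ^ m"
proof -
  let ?P = "{\<sigma>. \<sigma> permutes {1..n}}" and ?M = "Pi_pmf (nsets {1..n} k) False (\<lambda>_. bernoulli_pmf p)"
  have P: "finite ?P" "card ?P = fact n"
    by (simp_all add: finite_permutations card_permutations)
  have fN: "finite (nsets {1..n} k)" by (rule finite_imp_finite_nsets) simp
  have "measure_pmf.prob ?M (\<Union>\<sigma>\<in>?P. {X. \<forall>e\<in>(`) \<sigma> ` wins. X e})
      \<le> (\<Sum>\<sigma>\<in>?P. measure_pmf.prob ?M {X. \<forall>e\<in>(`) \<sigma> ` wins. X e})"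
    by (rule measure_pmf.finite_measure_subadditive_finite) (use P in auto)
  also have "\<dots> = (\<Sum>\<sigma>\<in>?P. p ^ m)"
    using prob_Pi_bernoulli_all[OF fN image_wins(1) p] image_wins(2) by (intro sum.cong) auto
  also have "\<dots> = fact n * p ^ m" using P(2) by simp
  finally show ?thesis unfolding prob_random_hypergraph(1)[OF l] .
qed

end

section \<open>Asymptotics\<close>

lemma multiples_at_top_le: "multiples_at_top d \<le> sequentially"
  by (simp add: multiples_at_top_def)

lemma multiples_at_top_1: "multiples_at_top (Suc 0) = sequentially"
  by (simp add: multiples_at_top_def)

lemma eventually_multiples_at_top_dvd: "eventually (\<lambda>n. d dvd n) (multiples_at_top d)"
  by (simp add: multiples_at_top_def eventually_inf_principal)

lemma whp_iff_complement:
  "whp F M P \<longleftrightarrow> ((\<lambda>n. measure_pmf.prob (M n) {H. \<not> P H}) \<longlongrightarrow> 0) F"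
proof -
  have "measure_pmf.prob (M n) {H. \<not> P H} = 1 - measure_pmf.prob (M n) {H. P H}" for n
    using measure_pmf.prob_compl[of "{H. P H}" "M n"] by (simp add: Compl_eq_Diff_UNIV[symmetric] Collect_neg_eq)
  then have eq: "(\<lambda>n. measure_pmf.prob (M n) {H. \<not> P H}) = (\<lambda>n. 1 - measure_pmf.prob (M n) {H. P H})"
    by (rule ext)
  show ?thesis unfolding whp_def eq
  proof
    assume "((\<lambda>n. measure_pmf.prob (M n) {H. P H}) \<longlongrightarrow> 1) F"
    from tendsto_diff[OF tendsto_const[of 1] this]
    show "((\<lambda>n. 1 - measure_pmf.prob (M n) {H. P H}) \<longlongrightarrow> 0) F" by simp
  next
    assume "((\<lambda>n. 1 - measure_pmf.prob (M n) {H. P H}) \<longlongrightarrow> 0) F"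
    from tendsto_diff[OF tendsto_const[of 1] this]
    show "((\<lambda>n. measure_pmf.prob (M n) {H. P H}) \<longlongrightarrow> 1) F" by simp
  qed
qed

text \<open>With \<open>\<rho> = root N r\<close> and \<open>j = n div N\<close> the sequence is bounded, up to a constant, by
  \<open>((j + 1) * \<rho> ^ j) ^ N\<close>, whose base tends to \<open>0\<close>.\<close>

lemma power_times_geometric_tendsto_0:
  fixes r :: real
  assumes r: "0 < r" "r < 1" and N: "0 < N"
  shows "(\<lambda>n. real n ^ N * r ^ (n div N - a)) \<longlonglongrightarrow> 0"
proof -
  define \<rho> where "\<rho> = root N r"
  have \<rho>: "0 \<le> \<rho>" "\<rho> < 1" "\<rho> ^ N = r"
    using r N by (auto simp: \<rho>_def)
  have "(\<lambda>j. real j * \<rho> ^ j) \<longlonglongrightarrow> 0" "(\<lambda>j. \<rho> ^ j) \<longlonglongrightarrow> 0"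
    using \<rho> by (auto intro!: powser_times_n_limit_0 LIMSEQ_power_zero)
  from tendsto_mult[OF tendsto_const[of "real N"] tendsto_add[OF this]]
  have "(\<lambda>j. real N * (real j * \<rho> ^ j + \<rho> ^ j)) \<longlonglongrightarrow> 0" by simp
  from tendsto_divide[OF tendsto_power[OF this, of N] tendsto_const[of "r ^ a"]]
  have "(\<lambda>j. (real N * (real j * \<rho> ^ j + \<rho> ^ j)) ^ N / r ^ a) \<longlonglongrightarrow> 0"
    using r N by (simp add: zero_power)
  moreover have "filterlim (\<lambda>n. n div N) sequentially sequentially"
    unfolding filterlim_at_top
  proof
    fix Z
    show "eventually (\<lambda>n. Z \<le> n div N) sequentially"
      using eventually_ge_at_top[of "Z * N"]
      by eventually_elim (use N in \<open>simp add: less_eq_div_iff_mult_less_eq\<close>)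
  qed
  ultimately have lim: "(\<lambda>n. (real N * (real (n div N) * \<rho> ^ (n div N) + \<rho> ^ (n div N))) ^ N / r ^ a) \<longlonglongrightarrow> 0"
    by (auto intro: filterlim_compose)
  have "real n ^ N * r ^ (n div N - a) \<le> (real N * (real (n div N) * \<rho> ^ (n div N) + \<rho> ^ (n div N))) ^ N / r ^ a" for n
  proof -
    define j where "j = n div N"
    have "n \<le> N * (j + 1)"
      using dividend_less_times_div[OF N, of n] by (simp add: j_def)
    then have "real n \<le> real N * (real j + 1)" by (metis of_nat_1 of_nat_add of_nat_le_iff of_nat_mult)
    then have *: "real n ^ N \<le> (real N * (real j + 1)) ^ N" by (intro power_mono) auto
    have "r ^ (j - a) \<le> r ^ j / r ^ a"
    proof (cases "a \<le> j")
      case True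
      then show ?thesis using r by (simp add: power_diff)
    next
      case False
      then have "r ^ a \<le> r ^ j" using r by (intro power_decreasing) auto
      then show ?thesis using False r by simp
    qed
    with * have "real n ^ N * r ^ (j - a) \<le> (real N * (real j + 1)) ^ N * (r ^ j / r ^ a)"
      using r by (intro mult_mono) auto
    also have "\<dots> = (real N * (real j * \<rho> ^ j + \<rho> ^ j)) ^ N / r ^ a"
    proof -
      have "(real N * (real j * \<rho> ^ j + \<rho> ^ j)) ^ N = ((real N * (real j + 1)) * \<rho> ^ j) ^ N"
        by (simp add: algebra_simps)
      also have "\<dots> = (real N * (real j + 1)) ^ N * (\<rho> ^ j) ^ N" by (rule power_mult_distrib)
      also have "(\<rho> ^ j) ^ N = r ^ j" unfolding \<rho>(3)[symmetric] 
        unfolding power_mult[symmetric] by (subst mult.commute) (rule refl)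
      finally show ?thesis by simp
    qed
    finally show ?thesis unfolding j_def .
  qed
  then show ?thesis
    by (intro tendsto_sandwich[OF _ _ tendsto_const lim]) (use r in auto)
qed

section \<open>Below the threshold\<close>

text \<open>A union bound over all permutations. Replacing \<open>1 - \<epsilon>\<close> by a number in \<open>(0, 1)\<close> that is no smaller
  covers \<open>\<epsilon> \<ge> 1\<close> as well.\<close>

lemma whp_not_hamiltonian:
  fixes p :: "nat \<Rightarrow> real"
  assumes l: "1 \<le> l" "l < k" and p: "\<And>n. 0 \<le> p n" "\<And>n. p n \<le> 1" and \<epsilon>: "0 < \<epsilon>"
    and le: "eventually (\<lambda>n. p n \<le> (1 - \<epsilon>) * exp 1 ^ (k - l) / real n ^ (k - l)) (multiples_at_top (k - l))"
  shows "whp (multiples_at_top (k - l)) (\<lambda>n. random_hypergraph k n (p n)) (\<lambda>H. \<not> l_hamiltonian k l H)"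
proof -
  let ?F = "multiples_at_top (k - l)"
  define d where "d = k - l"
  have d: "0 < d" "d < k" using l by (auto simp: d_def)
  define c where "c = max (1 / 2) (1 - \<epsilon>)"
  have c: "0 < c" "c < 1" "1 - \<epsilon> \<le> c" using \<epsilon> by (auto simp: c_def)
  define \<rho> where "\<rho> = root d c"
  have \<rho>: "0 \<le> \<rho>" "\<rho> < 1" "\<rho> ^ d = c" using c d by (auto simp: \<rho>_def)
  have "(\<lambda>n. exp 1 * (real n * \<rho> ^ n)) \<longlonglongrightarrow> exp 1 * 0"
    by (intro tendsto_mult tendsto_const powser_times_n_limit_0) (use \<rho> in simp)
  then have lim: "((\<lambda>n. exp 1 * (real n * \<rho> ^ n)) \<longlongrightarrow> 0) ?F"
    using tendsto_mono[OF multiples_at_top_le] by fastforce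
  have "eventually (\<lambda>n. 2 * k \<le> n) ?F"
    using eventually_ge_at_top multiples_at_top_le filter_leD by blast
  then have "eventually (\<lambda>n. measure_pmf.prob (random_hypergraph k n (p n)) {H. l_hamiltonian k l H}
      \<le> exp 1 * (real n * \<rho> ^ n)) ?F"
    using le eventually_multiples_at_top_dvd
  proof eventually_elim
    case (elim n)
    define m where "m = n div d"
    have n: "n = m * d" "2 * k \<le> n" using elim by (auto simp: m_def d_def)
    then interpret cyclic_windows k d m n by unfold_locales (use d in auto)
    have n0: "0 < n" using n d by linarith
    have "p n \<le> c * (exp 1 / real n) ^ d"
    proof -
      have "(1 - \<epsilon>) * (exp 1 ^ d / real n ^ d) \<le> c * (exp 1 ^ d / real n ^ d)"
        using c(3) by (intro mult_right_mono) auto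
      then show ?thesis using elim(2) by (simp add: d_def power_divide)
    qed
    then have "p n ^ m \<le> (c * (exp 1 / real n) ^ d) ^ m" using p by (intro power_mono) auto
    also have "\<dots> = \<rho> ^ n * (exp 1 / real n) ^ n"
      unfolding \<rho>(3)[symmetric] n(1) power_mult_distrib power_mult[symmetric] by (simp add: mult.commute)
    finally have "fact n * p n ^ m \<le> fact n * (\<rho> ^ n * (exp 1 / real n) ^ n)"
      by (intro mult_left_mono) auto
    also have "\<dots> = \<rho> ^ n * (fact n * exp 1 ^ n) / real n ^ n" by (simp add: power_divide)
    also have "\<dots> \<le> \<rho> ^ n * (exp 1 * real n ^ (n + 1)) / real n ^ n"
      using \<rho> n0 by (intro divide_right_mono mult_left_mono fact_exp_le) auto
    also have "\<dots> = exp 1 * (real n * \<rho> ^ n)" using n0 by simp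
    finally show ?case
      using prob_hamiltonian_le[OF l d_def p(1) p(2), of n] by linarith
  qed
  then have "((\<lambda>n. measure_pmf.prob (random_hypergraph k n (p n)) {H. l_hamiltonian k l H}) \<longlongrightarrow> 0) ?F"
    by (intro tendsto_sandwich[OF _ _ tendsto_const lim]) auto
  then show ?thesis unfolding whp_iff_complement by simp
qed

section \<open>Above the threshold\<close>

text \<open>The common form of the three positive results. The hypothesis on \<open>c0\<close> makes an appended adjacent
  window cost less than \<open>1\<close>; its case distinction reflects that the continuation is forced when
  \<open>k - l = 1\<close>. The last hypothesis says that a window started afresh costs \<open>o(1)\<close>.\<close>

lemma whp_hamiltonian:
  fixes p c :: "nat \<Rightarrow> real"
  assumes l: "2 \<le> l" "l < k" and p: "\<And>n. 0 \<le> p n" "\<And>n. p n \<le> 1"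
    and c0: "(if k - l = 1 then 1 else real k * real k ^ k) * exp 1 ^ (k - l) < c0"
    and c: "eventually (\<lambda>n. c0 \<le> c n) (multiples_at_top (k - l))"
    and le: "eventually (\<lambda>n. c n / real n ^ (k - l) \<le> p n) (multiples_at_top (k - l))"
    and y: "((\<lambda>n. real n ^ 2 / (real n ^ l * c n)) \<longlongrightarrow> 0) (multiples_at_top (k - l))"
  shows "whp (multiples_at_top (k - l)) (\<lambda>n. random_hypergraph k n (p n)) (l_hamiltonian k l)"
proof -
  let ?F = "multiples_at_top (k - l)"
  define d where "d = k - l"
  have d: "0 < d" "d < k" and k: "k = d + l" using l by (auto simp: d_def)
  define K where "K = (if d = 1 then 1 else real k * real k ^ k)"
  define y where "y n = real n ^ 2 / (real n ^ l * c n)" for n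
  \<comment> \<open>In the limit \<open>rate (1 / p)\<close> is at most \<open>q\<close>, and \<open>r\<close> is halfway between \<open>q\<close> and \<open>1\<close>.\<close>
  define C2 where "C2 = real k * (exp 1 ^ (2 * d) * (real k * real k ^ k)) / c0"
  define C3 where "C3 = exp 1 ^ k * real k ^ k"
  define q where "q = K * exp 1 ^ d / c0"
  define r where "r = (1 + q) / 2"
  have K0: "0 < K" using l by (auto simp: K_def)
  have Kc: "K * exp 1 ^ d < c0" using c0 by (simp add: K_def d_def)
  then have c0': "0 < c0" using K0 by (smt (verit) exp_gt_zero mult_pos_pos zero_less_power)
  have q: "0 < q" "q < 1" using K0 Kc c0' by (auto simp: q_def)
  then have r: "0 < r" "r < 1" "q < r" by (auto simp: r_def)
  have C: "0 \<le> C2" "0 \<le> C3" using c0' by (auto simp: C2_def C3_def)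
  have seq: "eventually P ?F" if "eventually P sequentially" for P
    using that multiples_at_top_le filter_leD by blast
  have ylim: "(y \<longlongrightarrow> 0) ?F" using y unfolding y_def .
  have rate_lim: "((\<lambda>n. q + C2 * (1 / real n) + C3 * y n) \<longlongrightarrow> q + C2 * 0 + C3 * 0) ?F"
    by (intro tendsto_add tendsto_mult tendsto_const ylim tendsto_mono[OF multiples_at_top_le] lim_1_over_n)
  then have ev_rate: "eventually (\<lambda>n. q + C2 * (1 / real n) + C3 * y n < r) ?F"
    using r(3) by (intro order_tendstoD(2)) auto
  define B where "B n = C3 * y n / (1 - r) * (1 + 2 ^ k / c0 ^ k * (real n ^ (d * k) * r ^ (n div (d * k) - (k + 1))))" for n
  have "((\<lambda>n. real n ^ (d * k) * r ^ (n div (d * k) - (k + 1))) \<longlongrightarrow> 0) ?F"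
    using power_times_geometric_tendsto_0[OF r(1,2), of "d * k" "k + 1"] d
    by (intro tendsto_mono[OF multiples_at_top_le]) simp
  then have "(B \<longlongrightarrow> C3 * 0 / (1 - r) * (1 + 2 ^ k / c0 ^ k * 0)) ?F"
    unfolding B_def using r by (intro tendsto_add tendsto_mult tendsto_divide tendsto_const ylim) auto
  then have Blim: "(B \<longlongrightarrow> 0) ?F" by simp
  have "eventually (\<lambda>n. 2 * k \<le> n \<and> (k + 1) * (d * k) \<le> n) ?F"
    by (rule seq) (intro eventually_conj eventually_ge_at_top)
  then have "eventually (\<lambda>n. measure_pmf.prob (random_hypergraph k n (p n)) {H. \<not> l_hamiltonian k l H} \<le> B n) ?F"
    using c le ev_rate eventually_multiples_at_top_dvd
  proof eventually_elim
    case (elim n)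
    define m where "m = n div d"
    have n: "n = m * d" "2 * k \<le> n" using elim by (auto simp: m_def d_def)
    then interpret cyclic_windows k d m n by unfold_locales (use d in auto)
    have n0: "0 < real n" using n d by linarith
    define x where "x = 1 / p n"
    have cn: "0 < c n" using elim(2) c0' by linarith
    have pn: "0 < p n"
    proof -
      have "0 < c n / real n ^ d" using cn n0 by simp
      then show ?thesis using elim(3) unfolding d_def by linarith
    qed
    have x: "0 \<le> x" "x \<le> real n ^ d / c n" "x \<le> real n ^ d / c0"
    proof -
      show "0 \<le> x" using pn by (simp add: x_def)
      have "c n \<le> p n * real n ^ d" using elim(3) n0 by (simp add: d_def pos_divide_le_eq)
      then show "x \<le> real n ^ d / c n" using pn cn by (simp add: x_def divide_simps mult.commute)
      also have "\<dots> \<le> real n ^ d / c0" using elim(2) c0' n0 by (intro divide_left_mono) auto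
      finally show "x \<le> real n ^ d / c0" .
    qed
    have "m * 1 \<le> m * d" using d by (intro mult_left_mono) auto
    then have "m \<le> n" unfolding n(1) by (simp only: mult_1_right)
    then have mn: "real m \<le> real n" by simp
    have start: "real m * start_weight x \<le> C3 * y n"
    proof -
      have "real m * start_weight x = (real m)\<^sup>2 * (x * ((exp 1 / real n) ^ k * real k ^ k))"
        by (simp add: start_weight_def power2_eq_square)
      also have "\<dots> \<le> (real n)\<^sup>2 * (real n ^ d / c n * ((exp 1 / real n) ^ k * real k ^ k))"
        using x mn n0 by (intro mult_mono power_mono) auto
      also have "\<dots> = C3 * y n"
      proof -
        have "real n ^ k = real n ^ d * real n ^ l" unfolding k by (rule power_add)
        then show ?thesis using n0 cn by (simp add: C3_def y_def power_divide field_simps)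
      qed
      finally show ?thesis .
    qed
    have rate: "rate x < r"
    proof -
      have 1: "x * (exp 1 / real n) ^ d * K \<le> q"
      proof -
        have "x * (exp 1 / real n) ^ d * K \<le> real n ^ d / c0 * (exp 1 / real n) ^ d * K"
          using x n0 K0 by (intro mult_right_mono) auto
        also have "\<dots> = q" using n0 by (simp add: q_def power_divide)
        finally show ?thesis .
      qed
      have 2: "real k * (x * (exp 1 / real n) ^ (2 * d) * (real k * real k ^ k)) \<le> C2 * (1 / real n)"
      proof -
        have "real k * (x * (exp 1 / real n) ^ (2 * d) * (real k * real k ^ k))
            \<le> real k * (real n ^ d / c0 * (exp 1 / real n) ^ (2 * d) * (real k * real k ^ k))"
          using x n0 by (intro mult_left_mono mult_right_mono) auto
        also have "\<dots> = C2 * (1 / real n ^ d)"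
        proof -
          have "real n ^ d / c0 * (exp 1 / real n) ^ (2 * d) = exp 1 ^ (2 * d) / c0 * (1 / real n ^ d)"
            unfolding power_divide mult_2 power_add using n0 by (simp add: divide_simps)
          then show ?thesis unfolding C2_def by simp
        qed
        also have "\<dots> \<le> C2 * (1 / real n)"
        proof -
          have "real n ^ 1 \<le> real n ^ d" using n0 d by (intro power_increasing) auto
          then show ?thesis using C n0 by (intro mult_left_mono divide_left_mono) auto
        qed
        finally show ?thesis .
      qed
      have "rate x = x * (exp 1 / real n) ^ d * K
          + real k * (x * (exp 1 / real n) ^ (2 * d) * (real k * real k ^ k)) + real m * start_weight x"
        by (simp only: rate_def K_def start_weight_def)
      then show ?thesis using 1 2 start elim(4) by linarith
    qed
    have mk: "m div k = n div (d * k)" by (simp add: m_def div_mult2_eq)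
    have "k < m div k"
    proof -
      have "(k + 1) * (d * k) \<le> n" using elim(1) by simp
      then have "k + 1 \<le> n div (d * k)" using d by (simp add: less_eq_div_iff_mult_less_eq)
      then show ?thesis unfolding mk by simp
    qed
    then have "measure_pmf.prob (random_hypergraph k n (p n)) {H. \<not> l_hamiltonian k l H}
        \<le> real m * start_weight x / (1 - rate x) * (1 + 2 ^ k * x ^ k * rate x ^ (m div k - k - 1))"
      using prob_no_image_wins_le[OF pn p(2)] rate r l d_def
      unfolding x_def by (subst prob_random_hypergraph(2)) auto
    also have "\<dots> \<le> C3 * y n / (1 - r) * (1 + 2 ^ k * (real n ^ d / c0) ^ k * r ^ (m div k - k - 1))"
    proof -
      have r0: "0 \<le> rate x" by (rule rate_nonneg[OF x(1)])
      have y0: "0 \<le> C3 * y n" using C cn by (simp add: y_def)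
      have le1: "real m * start_weight x / (1 - rate x) \<le> C3 * y n / (1 - r)"
        using y0 start rate r by (intro frac_le) auto
      have le2: "2 ^ k * x ^ k * rate x ^ (m div k - k - 1)
          \<le> 2 ^ k * (real n ^ d / c0) ^ k * r ^ (m div k - k - 1)"
        using x rate r0 by (intro mult_mono mult_left_mono power_mono) auto
      have "0 \<le> 2 ^ k * x ^ k * rate x ^ (m div k - k - 1)" using x(1) r0 by simp
      then show ?thesis
        using y0 r by (intro mult_mono[OF le1 add_left_mono[OF le2]]) auto
    qed
    also have "\<dots> = B n"
      unfolding B_def mk by (simp add: power_divide power_mult)
    finally show ?case .
  qed
  then have "((\<lambda>n. measure_pmf.prob (random_hypergraph k n (p n)) {H. \<not> l_hamiltonian k l H}) \<longlongrightarrow> 0) ?F"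
    by (intro tendsto_sandwich[OF _ _ tendsto_const Blim]) auto
  then show ?thesis unfolding whp_iff_complement .
qed

theorem theorem3:
  shows
    "(\<forall>(k::nat) (l::nat) (\<epsilon>::real) (p::nat \<Rightarrow> real).
        2 \<le> l \<and> l < k \<and> 0 < \<epsilon> \<and> (\<forall>n. 0 \<le> p n \<and> p n \<le> 1) \<and>
        (\<forall>\<^sub>F n in multiples_at_top (k - l). p n \<le> (1 - \<epsilon>) * exp 1 ^ (k - l) / real n ^ (k - l))
        \<longrightarrow> whp (multiples_at_top (k - l)) (\<lambda>n. random_hypergraph k n (p n))
              (\<lambda>H. \<not> l_hamiltonian k l H))
     \<and>
     (\<forall>k::nat. \<exists>c>0::real. \<forall>(l::nat) (p::nat \<Rightarrow> real).
        3 \<le> l \<and> l < k \<and> (\<forall>n. 0 \<le> p n \<and> p n \<le> 1) \<and>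
        (\<forall>\<^sub>F n in multiples_at_top (k - l). c / real n ^ (k - l) \<le> p n)
        \<longrightarrow> whp (multiples_at_top (k - l)) (\<lambda>n. random_hypergraph k n (p n))
              (l_hamiltonian k l))
     \<and>
     (\<forall>(k::nat) (p::nat \<Rightarrow> real) (\<omega>::nat \<Rightarrow> real).
        2 < k \<and> (\<forall>n. 0 \<le> p n \<and> p n \<le> 1) \<and> filterlim \<omega> at_top sequentially \<and>
        (\<forall>\<^sub>F n in multiples_at_top (k - 2). \<omega> n / real n ^ (k - 2) \<le> p n)
        \<longrightarrow> whp (multiples_at_top (k - 2)) (\<lambda>n. random_hypergraph k n (p n))
              (l_hamiltonian k 2))
     \<and>
     (\<forall>(k::nat) (\<epsilon>::real) (p::nat \<Rightarrow> real).
        4 \<le> k \<and> 0 < \<epsilon> \<and> (\<forall>n. 0 \<le> p n \<and> p n \<le> 1) \<and>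
        (\<forall>\<^sub>F n in sequentially. (1 + \<epsilon>) * exp 1 / real n \<le> p n)
        \<longrightarrow> whp sequentially (\<lambda>n. random_hypergraph k n (p n)) (tight_hamiltonian k))"
proof -
  have const_lim: "((\<lambda>n. real n ^ 2 / (real n ^ l * c)) \<longlongrightarrow> 0) (multiples_at_top d)"
    if "3 \<le> l" "0 < c" for l d :: nat and c :: real
  proof (rule tendsto_mono[OF multiples_at_top_le])
    have "(\<lambda>n. 1 / c * (1 / real n)) \<longlonglongrightarrow> 1 / c * 0"
      by (intro tendsto_mult tendsto_const lim_1_over_n)
    then have lim: "(\<lambda>n. 1 / c * (1 / real n)) \<longlonglongrightarrow> 0" by simp
    have "eventually (\<lambda>n. real n ^ 2 / (real n ^ l * c) \<le> 1 / c * (1 / real n)) sequentially"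
      using eventually_gt_at_top[of 0]
    proof eventually_elim
      case (elim n)
      have "real n ^ 3 \<le> real n ^ l" using elim that by (intro power_increasing) auto
      then have "real n ^ 2 / (real n ^ l * c) \<le> real n ^ 2 / (real n ^ 3 * c)"
        using elim that by (intro divide_left_mono mult_right_mono) auto
      also have "\<dots> = 1 / c * (1 / real n)"
        using elim by (simp add: power2_eq_square power3_eq_cube)
      finally show ?case .
    qed
    then show "(\<lambda>n. real n ^ 2 / (real n ^ l * c)) \<longlonglongrightarrow> 0"
      by (intro tendsto_sandwich[OF _ _ tendsto_const lim]) (use that in auto)
  qed
  have i: "whp (multiples_at_top (k - l)) (\<lambda>n. random_hypergraph k n (p n)) (\<lambda>H. \<not> l_hamiltonian k l H)"
    if "2 \<le> l \<and> l < k \<and> 0 < \<epsilon> \<and> (\<forall>n. 0 \<le> p n \<and> p n \<le> 1) \<and>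
      (\<forall>\<^sub>F n in multiples_at_top (k - l). p n \<le> (1 - \<epsilon>) * exp 1 ^ (k - l) / real n ^ (k - l))"
    for k l \<epsilon> p
    using that by (intro whp_not_hamiltonian[where \<epsilon> = \<epsilon>]) auto
  have ii: "\<exists>c>0::real. \<forall>l p. 3 \<le> l \<and> l < k \<and> (\<forall>n. 0 \<le> p n \<and> p n \<le> 1) \<and>
      (\<forall>\<^sub>F n in multiples_at_top (k - l). c / real n ^ (k - l) \<le> p n)
      \<longrightarrow> whp (multiples_at_top (k - l)) (\<lambda>n. random_hypergraph k n (p n)) (l_hamiltonian k l)" for k
  proof -
    \<comment> \<open>a bound for the constants needed by all \<open>l < k\<close>; the \<open>1\<close> keeps it positive for \<open>k = 0\<close>\<close>
    define c where "c = real k * real k ^ k * exp 1 ^ k + 1"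
    have c: "0 < c" by (simp add: c_def add_nonneg_pos)
    have "whp (multiples_at_top (k - l)) (\<lambda>n. random_hypergraph k n (p n)) (l_hamiltonian k l)"
      if *: "3 \<le> l \<and> l < k \<and> (\<forall>n. 0 \<le> p n \<and> p n \<le> 1) \<and>
        (\<forall>\<^sub>F n in multiples_at_top (k - l). c / real n ^ (k - l) \<le> p n)" for l p
    proof (rule whp_hamiltonian[where c = "\<lambda>_. c" and ?c0.0 = c])
      have "1 \<le> k" using * by linarith
      then have "1 * 1 \<le> real k * real k ^ k" by (intro mult_mono one_le_power) auto
      then have "(if k - l = 1 then 1 else real k * real k ^ k) * exp 1 ^ (k - l)
          \<le> real k * real k ^ k * exp 1 ^ k"
        by (intro mult_mono power_increasing) auto
      then show "(if k - l = 1 then 1 else real k * real k ^ k) * exp 1 ^ (k - l) < c"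
        by (simp add: c_def)
    qed (use * c const_lim in auto)
    then show ?thesis using c by blast
  qed
  have iii: "whp (multiples_at_top (k - 2)) (\<lambda>n. random_hypergraph k n (p n)) (l_hamiltonian k 2)"
    if *: "2 < k \<and> (\<forall>n. 0 \<le> p n \<and> p n \<le> 1) \<and> filterlim \<omega> at_top sequentially \<and>
      (\<forall>\<^sub>F n in multiples_at_top (k - 2). \<omega> n / real n ^ (k - 2) \<le> p n)" for k p and \<omega> :: "nat \<Rightarrow> real"
  proof (rule whp_hamiltonian[where c = \<omega>
        and ?c0.0 = "(if k - 2 = 1 then 1 else real k * real k ^ k) * exp 1 ^ (k - 2) + 1"])
    have \<omega>: "filterlim \<omega> at_top (multiples_at_top (k - 2))"
      using * multiples_at_top_le by (blast intro: filterlim_mono)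
    then show "\<forall>\<^sub>F n in multiples_at_top (k - 2).
        (if k - 2 = 1 then 1 else real k * real k ^ k) * exp 1 ^ (k - 2) + 1 \<le> \<omega> n"
      by (simp add: filterlim_at_top)
    have "((\<lambda>n. inverse (\<omega> n)) \<longlongrightarrow> 0) (multiples_at_top (k - 2))"
      by (rule tendsto_inverse_0_at_top[OF \<omega>])
    moreover have "\<forall>\<^sub>F n in multiples_at_top (k - 2). inverse (\<omega> n) = real n ^ 2 / (real n ^ 2 * \<omega> n)"
    proof -
      have "\<forall>\<^sub>F n in multiples_at_top (k - 2). (0::nat) < n"
        using filter_leD[OF multiples_at_top_le eventually_gt_at_top] .
      then show ?thesis by eventually_elim (simp add: field_simps)
    qed
    ultimately show "((\<lambda>n. real n ^ 2 / (real n ^ 2 * \<omega> n)) \<longlongrightarrow> 0) (multiples_at_top (k - 2))"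
      by (rule Lim_transform_eventually)
  qed (use * in auto)
  have iv: "whp sequentially (\<lambda>n. random_hypergraph k n (p n)) (tight_hamiltonian k)"
    if *: "4 \<le> k \<and> 0 < \<epsilon> \<and> (\<forall>n. 0 \<le> p n \<and> p n \<le> 1) \<and>
      (\<forall>\<^sub>F n in sequentially. (1 + \<epsilon>) * exp 1 / real n \<le> p n)" for k \<epsilon> p
  proof -
    have k1: "k - (k - 1) = Suc 0" using * by linarith
    have "whp (multiples_at_top (k - (k - 1))) (\<lambda>n. random_hypergraph k n (p n)) (tight_hamiltonian k)"
    proof (rule whp_hamiltonian[where c = "\<lambda>_. (1 + \<epsilon>) * exp 1" and ?c0.0 = "(1 + \<epsilon>) * exp 1"])
      show "((\<lambda>n. real n ^ 2 / (real n ^ (k - 1) * ((1 + \<epsilon>) * exp 1))) \<longlongrightarrow> 0)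
          (multiples_at_top (k - (k - 1)))"
        by (rule const_lim) (use * in \<open>auto intro!: mult_pos_pos\<close>)
    qed (use * in \<open>auto simp: k1 multiples_at_top_1\<close>)
    then show ?thesis unfolding k1 multiples_at_top_1 .
  qed
  show ?thesis using i ii iii iv by blast
qed

end
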